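(* Let $(\varphi,Q,\xi,\eta,g)$ be a weak almost contact metric structure on a smooth manifold $M^{2n+1}$. Then $(\varphi,Q,\xi,\eta,g)$ is weak Sasakian if and only if it is homothetically equivalent to a Sasakian structure $(\varphi',\xi,\eta,g')$ on $M^{2n+1}$.
   Context: A weak almost contact structure on a smooth manifold $M^{2n+1}$ is a set $(\varphi,Q,\xi,\eta)$, where $\varphi$ is a $(1,1)$-tensor field, $\xi$ a vector field, $\eta$ a 1-form and $Q$ a nonsingular $(1,1)$-tensor field, such that $\varphi^2=-Q+\eta\otimes Q\xi$, $\eta(\xi)=1$, $Q\xi=\nu\,\xi$ for a positive constant $\nu$, and the distribution $\mathcal D:=\ker\eta$ is $\varphi$-invariant ($\varphi X\in\mathcal D$ for $X\in\mathcal D$). It is a weak almost contact metric structure $(\varphi,Q,\xi,\eta,g)$ if $g$ is a Riemannian metric with $g(\varphi X,\varphi Y)=g(X,QY)-\eta(X)\,\eta(QY)$ for all vector fields $X,Y$. Conventions: $\Phi(X,Y)=g(X,\varphi Y)$ and $d\eta(X,Y)=\frac12\{X(\eta(Y))-Y(\eta(X))-\eta([X,Y])\}$. A weak contact metric structure is a weak almost contact metric structure with $\Phi=d\eta$. The structure is normal if $N^{(1)}=0$, where $N^{(1)}(X,Y)=[\varphi,\varphi](X,Y)+2\,d\eta(X,Y)\,Q\xi$ and $[\varphi,\varphi](X,Y)=\varphi^2[X,Y]+[\varphi X,\varphi Y]-\varphi[\varphi X,Y]-\varphi[X,\varphi Y]$. A weak Sasakian structure is a normal weak contact metric structure. A Sasakian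 structure $(\varphi',\xi,\eta,g')$ is a weak Sasakian structure with $Q'=\mathrm{id}_{TM}$ (so $\nu'=1$). Homothetic equivalence: $(\varphi,Q,\xi,\eta,g)$ and $(\varphi',Q',\xi,\eta,g')$ on $M$ (with the same $\xi,\eta$) are homothetically equivalent, in the sense used for weak Sasakian structures, if for some positive real constant $\lambda$: $\varphi=\sqrt\lambda\,\varphi'$; $Q|_{\mathcal D}=\lambda\,Q'|_{\mathcal D}$ and $Q\xi=\lambda\,Q'\xi$; $g|_{\mathcal D}=\lambda^{-1/2}\,g'|_{\mathcal D}$ and $\iota_\xi g=\iota_\xi g'$ (i.e. $g(\xi,\cdot)=g'(\xi,\cdot)$). For a Sasakian structure $(\varphi',\xi,\eta,g')$ one takes $Q'=\mathrm{id}_{TM}$. *)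

theory Defs
  imports "HOL-Analysis.Analysis" "HOL-Library.Function_Algebras"
begin

text \<open>Tangent vectors are functionals on real-valued functions, so the vector space operations on
  them are the pointwise ones.\<close>

instantiation "fun" :: (type, real_vector) real_vector
begin

definition scaleR_fun :: "real \<Rightarrow> ('a \<Rightarrow> 'b) \<Rightarrow> 'a \<Rightarrow> 'b"
  where "scaleR_fun c v = (\<lambda>x. c *\<^sub>R v x)"

instance
  by standard (auto simp: scaleR_fun_def fun_eq_iff algebra_simps)

end


section \<open>Smooth manifolds\<close>

text \<open>Class $C^k$ on an open subset of a Euclidean space: all iterated partial derivatives up to
  order $k$ exist and are continuous.\<close>

fun Ck_on :: "nat \<Rightarrow> 'e::euclidean_space set \<Rightarrow> ('e \<Rightarrow> 'b::real_normed_vector) \<Rightarrow> bool"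
  where
    "Ck_on 0 S f \<longleftrightarrow> continuous_on S f"
  | "Ck_on (Suc k) S f \<longleftrightarrow>
       (\<forall>x\<in>S. f differentiable (at x)) \<and>
       (\<forall>b\<in>Basis. Ck_on k S (\<lambda>x. frechet_derivative f (at x) b))"

definition smooth_on :: "'e::euclidean_space set \<Rightarrow> ('e \<Rightarrow> 'b::real_normed_vector) \<Rightarrow> bool"
  where "smooth_on S f \<longleftrightarrow> (\<forall>k. Ck_on k S f)"

type_synonym ('a, 'e) chart = "'a set \<times> ('a \<Rightarrow> 'e)"

definition is_chart :: "('a::topological_space, 'e::euclidean_space) chart \<Rightarrow> bool"
  where "is_chart c \<longleftrightarrow> (case c of (U, \<psi>) \<Rightarrow>
    open U \<and> open (\<psi> ` U) \<and> homeomorphism U (\<psi> ` U) \<psi> (inv_into U \<psi>))"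

text \<open>The manifold is the whole type \<open>'a\<close>, Hausdorff and second countable by its sort, of dimension
  \<open>DIM('e)\<close>. Its smooth structure is given by any smooth atlas, not necessarily a maximal one.\<close>

definition smooth_manifold ::
    "('a::{t2_space,second_countable_topology}, 'e::euclidean_space) chart set \<Rightarrow> bool"
  where "smooth_manifold A \<longleftrightarrow>
    (\<forall>c\<in>A. is_chart c) \<and>
    (\<Union>(U, \<psi>)\<in>A. U) = UNIV \<and>
    (\<forall>(U, \<psi>)\<in>A. \<forall>(V, \<theta>)\<in>A. smooth_on (\<psi> ` (U \<inter> V)) (\<theta> \<circ> inv_into U \<psi>))"

definition smooth_funs :: "('a::topological_space, 'e::euclidean_space) chart set \<Rightarrow> ('a \<Rightarrow> real) set"
  where "smooth_funs A = {f. \<forall>(U, \<psi>)\<in>A. smooth_on (\<psi> ` U) (f \<circ> inv_into U \<psi>)}"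


section \<open>Tangent vectors and tensor fields\<close>

type_synonym 'a tvec = "('a \<Rightarrow> real) \<Rightarrow> real"
type_synonym 'a vfield = "'a \<Rightarrow> 'a tvec"
type_synonym 'a oneform = "'a \<Rightarrow> 'a tvec \<Rightarrow> real"
type_synonym 'a endofield = "'a \<Rightarrow> 'a tvec \<Rightarrow> 'a tvec"
type_synonym 'a bilinfield = "'a \<Rightarrow> 'a tvec \<Rightarrow> 'a tvec \<Rightarrow> real"

text \<open>The tangent space at \<open>p\<close> consists of the derivations at \<open>p\<close> of the algebra of smooth functions.
  HOL functions being total, a derivation is set to \<open>0\<close> on nonsmooth functions; thus
  equality of tangent vectors is HOL equality.\<close>

definition tangent_space ::
    "('a::topological_space, 'e::euclidean_space) chart set \<Rightarrow> 'a \<Rightarrow> 'a tvec set"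
  where "tangent_space A p = {v.
    (\<forall>f\<in>smooth_funs A. \<forall>g\<in>smooth_funs A. v (f + g) = v f + v g) \<and>
    (\<forall>c. \<forall>f\<in>smooth_funs A. v (c *\<^sub>R f) = c * v f) \<and>
    (\<forall>f\<in>smooth_funs A. \<forall>g\<in>smooth_funs A. v (f * g) = f p * v g + g p * v f) \<and>
    (\<forall>f. f \<notin> smooth_funs A \<longrightarrow> v f = 0)}"

definition vector_fields :: "('a::topological_space, 'e::euclidean_space) chart set \<Rightarrow> 'a vfield set"
  where "vector_fields A = {X.
    (\<forall>p. X p \<in> tangent_space A p) \<and> (\<forall>f\<in>smooth_funs A. (\<lambda>p. X p f) \<in> smooth_funs A)}"

definition lie_bracket ::
    "('a::topological_space, 'e::euclidean_space) chart set \<Rightarrow> 'a vfield \<Rightarrow> 'a vfield \<Rightarrow> 'a vfield"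
  where "lie_bracket A X Y = (\<lambda>p f.
    if f \<in> smooth_funs A then X p (\<lambda>q. Y q f) - Y p (\<lambda>q. X q f) else 0)"

text \<open>Values of a tensor field off the tangent spaces are irrelevant junk.\<close>

definition one_form :: "('a::topological_space, 'e::euclidean_space) chart set \<Rightarrow> 'a oneform \<Rightarrow> bool"
  where "one_form A \<eta> \<longleftrightarrow>
    (\<forall>p. \<forall>u\<in>tangent_space A p. \<forall>v\<in>tangent_space A p. \<forall>a b.
       \<eta> p (a *\<^sub>R u + b *\<^sub>R v) = a * \<eta> p u + b * \<eta> p v) \<and>
    (\<forall>X\<in>vector_fields A. (\<lambda>p. \<eta> p (X p)) \<in> smooth_funs A)"

definition apply_field :: "'a endofield \<Rightarrow> 'a vfield \<Rightarrow> 'a vfield"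
  where "apply_field \<phi> X = (\<lambda>p. \<phi> p (X p))"

definition tensor_field11 ::
    "('a::topological_space, 'e::euclidean_space) chart set \<Rightarrow> 'a endofield \<Rightarrow> bool"
  where "tensor_field11 A \<phi> \<longleftrightarrow>
    (\<forall>p. \<forall>v\<in>tangent_space A p. \<phi> p v \<in> tangent_space A p) \<and>
    (\<forall>p. \<forall>u\<in>tangent_space A p. \<forall>v\<in>tangent_space A p. \<forall>a b.
       \<phi> p (a *\<^sub>R u + b *\<^sub>R v) = a *\<^sub>R \<phi> p u + b *\<^sub>R \<phi> p v) \<and>
    (\<forall>X\<in>vector_fields A. apply_field \<phi> X \<in> vector_fields A)"

definition nonsingular ::
    "('a::topological_space, 'e::euclidean_space) chart set \<Rightarrow> 'a endofield \<Rightarrow> bool"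
  where "nonsingular A Q \<longleftrightarrow> (\<forall>p. bij_betw (Q p) (tangent_space A p) (tangent_space A p))"

text \<open>Linearity in the second argument of a metric follows from symmetry.\<close>

definition riemannian_metric ::
    "('a::topological_space, 'e::euclidean_space) chart set \<Rightarrow> 'a bilinfield \<Rightarrow> bool"
  where "riemannian_metric A g \<longleftrightarrow>
    (\<forall>p. \<forall>u\<in>tangent_space A p. \<forall>v\<in>tangent_space A p. g p u v = g p v u) \<and>
    (\<forall>p. \<forall>u\<in>tangent_space A p. \<forall>v\<in>tangent_space A p. \<forall>w\<in>tangent_space A p. \<forall>a b.
       g p (a *\<^sub>R u + b *\<^sub>R v) w = a * g p u w + b * g p v w) \<and>
    (\<forall>p. \<forall>v\<in>tangent_space A p. v \<noteq> 0 \<longrightarrow> g p v v > 0) \<and>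
    (\<forall>X\<in>vector_fields A. \<forall>Y\<in>vector_fields A. (\<lambda>p. g p (X p) (Y p)) \<in> smooth_funs A)"

definition kernel_distribution ::
    "('a::topological_space, 'e::euclidean_space) chart set \<Rightarrow> 'a oneform \<Rightarrow> 'a \<Rightarrow> 'a tvec set"
  where "kernel_distribution A \<eta> p = {v \<in> tangent_space A p. \<eta> p v = 0}"

text \<open>The exterior derivative with the factor $\frac12$.\<close>

definition ext_deriv ::
    "('a::topological_space, 'e::euclidean_space) chart set \<Rightarrow> 'a oneform \<Rightarrow>
     'a vfield \<Rightarrow> 'a vfield \<Rightarrow> 'a \<Rightarrow> real"
  where "ext_deriv A \<eta> X Y p =
    (X p (\<lambda>q. \<eta> q (Y q)) - Y p (\<lambda>q. \<eta> q (X q)) - \<eta> p (lie_bracket A X Y p)) / 2"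


section \<open>Weak almost contact metric structures\<close>

definition weak_almost_contact ::
    "('a::topological_space, 'e::euclidean_space) chart set \<Rightarrow>
     'a endofield \<Rightarrow> 'a endofield \<Rightarrow> 'a vfield \<Rightarrow> 'a oneform \<Rightarrow> bool"
  where "weak_almost_contact A \<phi> Q \<xi> \<eta> \<longleftrightarrow>
    tensor_field11 A \<phi> \<and> tensor_field11 A Q \<and> nonsingular A Q \<and>
    \<xi> \<in> vector_fields A \<and> one_form A \<eta> \<and>
    (\<forall>p. \<forall>v\<in>tangent_space A p. \<phi> p (\<phi> p v) = - Q p v + \<eta> p v *\<^sub>R Q p (\<xi> p)) \<and>
    (\<forall>p. \<eta> p (\<xi> p) = 1) \<and>
    (\<exists>\<nu>>0. \<forall>p. Q p (\<xi> p) = \<nu> *\<^sub>R \<xi> p) \<and>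
    (\<forall>p. \<forall>v\<in>kernel_distribution A \<eta> p. \<phi> p v \<in> kernel_distribution A \<eta> p)"

definition weak_almost_contact_metric ::
    "('a::topological_space, 'e::euclidean_space) chart set \<Rightarrow>
     'a endofield \<Rightarrow> 'a endofield \<Rightarrow> 'a vfield \<Rightarrow> 'a oneform \<Rightarrow> 'a bilinfield \<Rightarrow> bool"
  where "weak_almost_contact_metric A \<phi> Q \<xi> \<eta> g \<longleftrightarrow>
    weak_almost_contact A \<phi> Q \<xi> \<eta> \<and> riemannian_metric A g \<and>
    (\<forall>p. \<forall>u\<in>tangent_space A p. \<forall>v\<in>tangent_space A p.
       g p (\<phi> p u) (\<phi> p v) = g p u (Q p v) - \<eta> p u * \<eta> p (Q p v))"

definition fundamental_form ::
    "'a endofield \<Rightarrow> 'a bilinfield \<Rightarrow> 'a vfield \<Rightarrow> 'a vfield \<Rightarrow> 'a \<Rightarrow> real"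
  where "fundamental_form \<phi> g X Y p = g p (X p) (\<phi> p (Y p))"

definition weak_contact_metric ::
    "('a::topological_space, 'e::euclidean_space) chart set \<Rightarrow>
     'a endofield \<Rightarrow> 'a endofield \<Rightarrow> 'a vfield \<Rightarrow> 'a oneform \<Rightarrow> 'a bilinfield \<Rightarrow> bool"
  where "weak_contact_metric A \<phi> Q \<xi> \<eta> g \<longleftrightarrow>
    weak_almost_contact_metric A \<phi> Q \<xi> \<eta> g \<and>
    (\<forall>X\<in>vector_fields A. \<forall>Y\<in>vector_fields A. \<forall>p.
       fundamental_form \<phi> g X Y p = ext_deriv A \<eta> X Y p)"

definition nijenhuis ::
    "('a::topological_space, 'e::euclidean_space) chart set \<Rightarrow> 'a endofield \<Rightarrow>
     'a vfield \<Rightarrow> 'a vfield \<Rightarrow> 'a vfield"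
  where "nijenhuis A \<phi> X Y = (\<lambda>p.
    \<phi> p (\<phi> p (lie_bracket A X Y p)) + lie_bracket A (apply_field \<phi> X) (apply_field \<phi> Y) p
    - \<phi> p (lie_bracket A (apply_field \<phi> X) Y p) - \<phi> p (lie_bracket A X (apply_field \<phi> Y) p))"

definition tensor_N1 ::
    "('a::topological_space, 'e::euclidean_space) chart set \<Rightarrow>
     'a endofield \<Rightarrow> 'a endofield \<Rightarrow> 'a vfield \<Rightarrow> 'a oneform \<Rightarrow> 'a vfield \<Rightarrow> 'a vfield \<Rightarrow> 'a vfield"
  where "tensor_N1 A \<phi> Q \<xi> \<eta> X Y = (\<lambda>p.
    nijenhuis A \<phi> X Y p + (2 * ext_deriv A \<eta> X Y p) *\<^sub>R Q p (\<xi> p))"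

definition normal_structure ::
    "('a::topological_space, 'e::euclidean_space) chart set \<Rightarrow>
     'a endofield \<Rightarrow> 'a endofield \<Rightarrow> 'a vfield \<Rightarrow> 'a oneform \<Rightarrow> bool"
  where "normal_structure A \<phi> Q \<xi> \<eta> \<longleftrightarrow>
    (\<forall>X\<in>vector_fields A. \<forall>Y\<in>vector_fields A. \<forall>p. tensor_N1 A \<phi> Q \<xi> \<eta> X Y p = 0)"

definition weak_Sasakian ::
    "('a::topological_space, 'e::euclidean_space) chart set \<Rightarrow>
     'a endofield \<Rightarrow> 'a endofield \<Rightarrow> 'a vfield \<Rightarrow> 'a oneform \<Rightarrow> 'a bilinfield \<Rightarrow> bool"
  where "weak_Sasakian A \<phi> Q \<xi> \<eta> g \<longleftrightarrow>
    weak_contact_metric A \<phi> Q \<xi> \<eta> g \<and> normal_structure A \<phi> Q \<xi> \<eta>"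

definition id_field :: "'a endofield"
  where "id_field p v = v"

definition Sasakian ::
    "('a::topological_space, 'e::euclidean_space) chart set \<Rightarrow>
     'a endofield \<Rightarrow> 'a vfield \<Rightarrow> 'a oneform \<Rightarrow> 'a bilinfield \<Rightarrow> bool"
  where "Sasakian A \<phi> \<xi> \<eta> g \<longleftrightarrow> weak_Sasakian A \<phi> id_field \<xi> \<eta> g"

definition homothetically_equivalent ::
    "('a::topological_space, 'e::euclidean_space) chart set \<Rightarrow> 'a vfield \<Rightarrow> 'a oneform \<Rightarrow>
     'a endofield \<Rightarrow> 'a endofield \<Rightarrow> 'a bilinfield \<Rightarrow>
     'a endofield \<Rightarrow> 'a endofield \<Rightarrow> 'a bilinfield \<Rightarrow> bool"
  where "homothetically_equivalent A \<xi> \<eta> \<phi> Q g \<phi>' Q' g' \<longleftrightarrow> (\<exists>\<kappa>>0.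
    (\<forall>p. \<forall>v\<in>tangent_space A p. \<phi> p v = sqrt \<kappa> *\<^sub>R \<phi>' p v) \<and>
    (\<forall>p. \<forall>v\<in>kernel_distribution A \<eta> p. Q p v = \<kappa> *\<^sub>R Q' p v) \<and>
    (\<forall>p. Q p (\<xi> p) = \<kappa> *\<^sub>R Q' p (\<xi> p)) \<and>
    (\<forall>p. \<forall>u\<in>kernel_distribution A \<eta> p. \<forall>v\<in>kernel_distribution A \<eta> p.
       g p u v = \<kappa> powr (- 1 / 2) * g' p u v) \<and>
    (\<forall>p. \<forall>v\<in>tangent_space A p. g p (\<xi> p) v = g' p (\<xi> p) v))"

end

(* For a weak Sasakian structure, the eta-component of N1(X,Y) = 0 reads
   eta([phi X, phi Y]) + 2 nu d eta(X,Y) = 0, that is, d eta(phi X, phi Y) = nu d eta(X,Y).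
   With Phi = d eta and the compatibility of g this becomes g(X, Q phi Y) = nu g(X, phi Y), hence
   Q = nu id, and phi' = phi / sqrt nu, g' = sqrt nu g + (1 - sqrt nu) eta (x) eta is Sasakian.
   Both Phi and, up to a constant factor, N1 are unchanged by a homothety, which gives the converse.
   Tangent vectors being derivations of the algebra of global smooth functions, these identities
   between vector fields are transferred to single tangent vectors by extending a tangent vector
   to a vector field. If F is f in a chart and rho is a bump function, multiplying Hadamard's
   expansion F(x) - F(a) = sum_i (x - a)_i G_i(x) by rho^2 makes it an identity between global
   smooth functions, so that v is determined by its values on the rho (x - a)_i. *)

theory Submission
  imports Defs
begin

section \<open>Calculus of functions of class $C^k$\<close>

text \<open>The identity g(X, Q phi Y) = nu g(X, phi Y) gives Q = nu id only on the image of phi.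
  That this image is all of ker eta uses the nonsingularity of Q: eta o Q = nu eta makes Q map ker
  eta onto itself, and there phi^2 = -Q. Along xi the value nu is given. The constant of the
  homothety is forced: Q xi = lambda xi gives lambda = nu. So is g': it must be sqrt nu g on ker
  eta, with g'(xi, .) = g(xi, .) = eta. For nu > 1 the summand (1 - sqrt nu) eta (x) eta is not
  positive, and positivity of g' rests on g(v, v) >= eta(v)^2. The obstacle is that d eta and N1 act
  on global vector fields, while the cancellation argument tests with one tangent vector chosen at
  one point. Since C^k is defined by iterated partial derivatives, smoothness is proved by induction
  on k, and where a function does not reproduce its form under differentiation a family closed under
  it is treated instead: exp(-1/t) t^(-m) for the bump function, ray integrals with weight t^m for
  Hadamard's coefficients.\<close>

lemma Ck_on_Suc_has_derivative:
  "Ck_on (Suc k) S f \<Longrightarrow> x \<in> S \<Longrightarrow> (f has_derivative frechet_derivative f (at x)) (at x)"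
  unfolding Ck_on.simps(2) using frechet_derivative_works by blast

text \<open>Openness turns equality on \<open>S\<close> into equality near each point, so the
  derivatives agree and the induction passes to the partial derivatives.\<close>

lemma Ck_on_cong:
  assumes "open S" "\<And>x. x \<in> S \<Longrightarrow> f x = g x" "Ck_on k S f"
  shows "Ck_on k S g"
  using assms(2,3)
proof (induction k arbitrary: f g)
  case 0
  then show ?case using continuous_on_cong[of S S f g] by auto
next
  case (Suc k)
  have D: "(g has_derivative frechet_derivative f (at x)) (at x)" if "x \<in> S" for x
    by (rule has_derivative_transform_within_open[OF Ck_on_Suc_has_derivative[OF Suc.prems(2) that]
        \<open>open S\<close> that Suc.prems(1)])
  have eq: "frechet_derivative f (at x) = frechet_derivative g (at x)" if "x \<in> S" for x
    using frechet_derivative_at[OF D[OF that]] .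
  have "Ck_on k S (\<lambda>x. frechet_derivative g (at x) b)" if "b \<in> Basis" for b
  proof (rule Suc.IH)
    show "frechet_derivative f (at x) b = frechet_derivative g (at x) b" if "x \<in> S" for x
      using eq[OF that] by (rule arg_cong)
    show "Ck_on k S (\<lambda>x. frechet_derivative f (at x) b)"
      using Suc.prems(2) \<open>b \<in> Basis\<close> unfolding Ck_on.simps(2) by blast
  qed
  moreover have "g differentiable (at x)" if "x \<in> S" for x
    using D[OF that] by (rule differentiableI)
  ultimately show ?case unfolding Ck_on.simps(2) by blast
qed

text \<open>Uniqueness of the derivative lets an explicit \<open>D\<close> stand for
  \<open>frechet_derivative\<close>. The closure rules below take \<open>D\<close> from a
  differentiation rule and apply the induction hypothesis to its components.\<close>

lemma Ck_on_SucI: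
  assumes "open S"
    and D: "\<And>x. x \<in> S \<Longrightarrow> (f has_derivative D x) (at x)"
    and Ck: "\<And>b. b \<in> Basis \<Longrightarrow> Ck_on k S (\<lambda>x. D x b)"
  shows "Ck_on (Suc k) S f"
proof -
  have "D x = frechet_derivative f (at x)" if "x \<in> S" for x
    using frechet_derivative_at[OF D[OF that]] .
  then have "Ck_on k S (\<lambda>x. frechet_derivative f (at x) b)" if "b \<in> Basis" for b
    using Ck_on_cong[OF \<open>open S\<close>, of "\<lambda>x. D x b" "\<lambda>x. frechet_derivative f (at x) b"] Ck[OF that]
    by simp
  moreover have "f differentiable (at x)" if "x \<in> S" for x
    using D[OF that] by (rule differentiableI)
  ultimately show ?thesis by simp
qed

lemma Ck_on_subset: "Ck_on k S f \<Longrightarrow> T \<subseteq> S \<Longrightarrow> Ck_on k T f"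
  by (induction k arbitrary: f) (auto intro: continuous_on_subset)

lemma Ck_on_Un: "open S \<Longrightarrow> open T \<Longrightarrow> Ck_on k S f \<Longrightarrow> Ck_on k T f \<Longrightarrow> Ck_on k (S \<union> T) f"
  by (induction k arbitrary: f) (auto intro: continuous_on_open_Un)

lemma Ck_on_imp_continuous_on: "Ck_on k S f \<Longrightarrow> continuous_on S f"
  by (cases k) (auto intro!: continuous_at_imp_continuous_on differentiable_imp_continuous_within)

lemma Ck_on_SucD: "Ck_on (Suc k) S f \<Longrightarrow> Ck_on k S f"
proof (induction k arbitrary: f)
  case 0
  then show ?case using Ck_on_imp_continuous_on[of "Suc 0"] by simp
next
  case (Suc k)
  have "Ck_on k S (\<lambda>x. frechet_derivative f (at x) b)" if "b \<in> Basis" for b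
    using Suc.IH Suc.prems that unfolding Ck_on.simps(2)[of _ S f] by blast
  moreover have "f differentiable (at x)" if "x \<in> S" for x
    using Suc.prems that by (simp only: Ck_on.simps(2))
  ultimately show ?case by simp
qed

lemma Ck_on_const: "Ck_on k S (\<lambda>x. c)"
  by (induction k arbitrary: c) auto

lemma Ck_on_add:
  assumes "open S"
  shows "Ck_on k S f \<Longrightarrow> Ck_on k S g \<Longrightarrow> Ck_on k S (\<lambda>x. f x + g x)"
proof (induction k arbitrary: f g)
  case 0
  then show ?case by (simp add: continuous_on_add)
next
  case (Suc k)
  show ?case
  proof (rule Ck_on_SucI[OF \<open>open S\<close>])
    fix x assume "x \<in> S"
    then show "((\<lambda>x. f x + g x) has_derivative (\<lambda>h. frechet_derivative f (at x) h
        + frechet_derivative g (at x) h)) (at x)"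
      using Suc.prems by (intro has_derivative_add Ck_on_Suc_has_derivative)
  next
    fix b :: 'a assume "b \<in> Basis"
    then show "Ck_on k S (\<lambda>x. frechet_derivative f (at x) b + frechet_derivative g (at x) b)"
      using Suc.prems by (intro Suc.IH) simp_all
  qed
qed

lemma Ck_on_sum:
  "open S \<Longrightarrow> (\<And>i. i \<in> I \<Longrightarrow> Ck_on k S (f i)) \<Longrightarrow> Ck_on k S (\<lambda>x. \<Sum>i\<in>I. f i x)"
  by (induction I rule: infinite_finite_induct) (auto intro: Ck_on_const Ck_on_add)

lemma Ck_on_scaleR:
  assumes "open S"
  shows "Ck_on k S f \<Longrightarrow> Ck_on k S g \<Longrightarrow> Ck_on k S (\<lambda>x. f x *\<^sub>R g x)"
proof (induction k arbitrary: f g)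
  case 0
  then show ?case by (simp add: continuous_on_scaleR)
next
  case (Suc k)
  show ?case
  proof (rule Ck_on_SucI[OF \<open>open S\<close>])
    fix x assume "x \<in> S"
    then show "((\<lambda>x. f x *\<^sub>R g x) has_derivative (\<lambda>h. f x *\<^sub>R frechet_derivative g (at x) h
        + frechet_derivative f (at x) h *\<^sub>R g x)) (at x)"
      using Suc.prems by (intro has_derivative_scaleR Ck_on_Suc_has_derivative)
  next
    fix b :: 'a assume "b \<in> Basis"
    \<comment> \<open>The undifferentiated factors of the Leibniz rule are of class
      \<open>Suc k\<close> and have to be lowered to order \<open>k\<close>.\<close>
    then show "Ck_on k S (\<lambda>x. f x *\<^sub>R frechet_derivative g (at x) b
        + frechet_derivative f (at x) b *\<^sub>R g x)"
      using Suc.prems Ck_on_SucD[OF Suc.prems(1)] Ck_on_SucD[OF Suc.prems(2)]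
      by (intro Ck_on_add[OF \<open>open S\<close>] Suc.IH) simp_all
  qed
qed

lemma Ck_on_mult:
  "open S \<Longrightarrow> Ck_on k S f \<Longrightarrow> Ck_on k S g \<Longrightarrow> Ck_on k S (\<lambda>x. f x * g x :: real)"
  using Ck_on_scaleR[of S k f g] by simp

lemma Ck_on_bounded_linear:
  fixes f :: "'e::euclidean_space \<Rightarrow> 'b::real_normed_vector"
    and L :: "'b \<Rightarrow> 'c::real_normed_vector"
  assumes "bounded_linear L" "open S"
  shows "Ck_on k S f \<Longrightarrow> Ck_on k S (\<lambda>x. L (f x))"
proof (induction k arbitrary: f)
  case 0
  then show ?case
    using assms(1) by (simp add: bounded_linear.continuous_on)
next
  case (Suc k)
  show ?case
  proof (rule Ck_on_SucI[OF \<open>open S\<close>])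
    fix x assume "x \<in> S"
    then show "((\<lambda>x. L (f x)) has_derivative (\<lambda>h. L (frechet_derivative f (at x) h))) (at x)"
      using Suc.prems by (intro bounded_linear.has_derivative[OF assms(1)] Ck_on_Suc_has_derivative)
  next
    fix b :: 'e assume "b \<in> Basis"
    then show "Ck_on k S (\<lambda>x. L (frechet_derivative f (at x) b))"
      using Suc.prems by (intro Suc.IH) simp_all
  qed
qed

lemma Ck_on_ident:
  assumes "open S"
  shows "Ck_on k S (\<lambda>x. x)"
proof (cases k)
  case (Suc m)
  show ?thesis
    unfolding Suc
    by (rule Ck_on_SucI[OF assms, where D = "\<lambda>x h. h"]) (auto simp: Ck_on_const)
qed simp

text \<open>Expanded in the standard basis, the chain rule gives sums of products of components of
  the derivative of \<open>G\<close> with partial derivatives of \<open>F\<close> taken at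
  \<open>G x\<close>. The latter are composites with the same \<open>G\<close>, so the induction
  varies only \<open>F\<close>.\<close>

lemma Ck_on_compose:
  fixes G :: "'d::euclidean_space \<Rightarrow> 'e::euclidean_space"
    and F :: "'e \<Rightarrow> 'b::real_normed_vector"
  assumes "open S" "open T" "G ` S \<subseteq> T"
  shows "Ck_on k S G \<Longrightarrow> Ck_on k T F \<Longrightarrow> Ck_on k S (\<lambda>x. F (G x))"
proof (induction k arbitrary: F)
  case 0
  then show ?case
    using continuous_on_compose2[of T F S G] assms(3) by simp
next
  case (Suc k)
  let ?D = "\<lambda>x b. \<Sum>j\<in>Basis. (frechet_derivative G (at x) b \<bullet> j) *\<^sub>R frechet_derivative F (at (G x)) j"
  show ?case
  proof (rule Ck_on_SucI[OF \<open>open S\<close>])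
    fix x assume x: "x \<in> S"
    then have DF: "(F has_derivative frechet_derivative F (at (G x))) (at (G x))"
      using Ck_on_Suc_has_derivative[OF Suc.prems(2)] assms(3) by blast
    interpret linear "frechet_derivative F (at (G x))"
      using DF by (rule has_derivative_linear)
    have "frechet_derivative F (at (G x)) (frechet_derivative G (at x) b) = ?D x b" for b
    proof -
      have "frechet_derivative F (at (G x)) (\<Sum>j\<in>Basis. (frechet_derivative G (at x) b \<bullet> j) *\<^sub>R j) = ?D x b"
        by (simp only: sum scale)
      then show ?thesis by (simp only: euclidean_representation)
    qed
    then show "((\<lambda>x. F (G x)) has_derivative ?D x) (at x)"
      using has_derivative_compose[OF Ck_on_Suc_has_derivative[OF Suc.prems(1) x] DF]
      by (simp only:)
  next
    fix b :: 'd assume b: "b \<in> Basis"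
    show "Ck_on k S (\<lambda>x. ?D x b)"
    proof (rule Ck_on_sum[OF \<open>open S\<close>], rule Ck_on_scaleR[OF \<open>open S\<close>])
      fix j :: 'e assume j: "j \<in> Basis"
      show "Ck_on k S (\<lambda>x. frechet_derivative G (at x) b \<bullet> j)"
        using Suc.prems(1) b by (intro Ck_on_bounded_linear[OF bounded_linear_inner_left \<open>open S\<close>]) simp
      show "Ck_on k S (\<lambda>x. frechet_derivative F (at (G x)) j)"
        using Suc.prems(2) j Ck_on_SucD[OF Suc.prems(1)] 
          by (intro Suc.IH[where F = "\<lambda>y. frechet_derivative F (at y) j"]) simp_all
    qed
  qed
qed

text \<open>The family is closed under differentiation: the derivative of member m is member m + 2
  minus m times member m + 1. Hence all m are treated at once; the bump function below is built from
  m = 0.\<close>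

lemma smooth_flat_exp:
  fixes m :: nat
  defines "h \<equiv> \<lambda>(m::nat) (t::real). if t > 0 then exp (- inverse t) * inverse t ^ m else 0"
  shows "Ck_on k UNIV (h m)"
proof -
  have lim: "((\<lambda>t. h m t) \<longlongrightarrow> 0) (at 0)" for m
  proof (rule filterlim_split_at_real)
    show "(h m \<longlongrightarrow> 0) (at_left 0)"
      by (rule tendsto_eventually) (auto simp: h_def eventually_at_left_field intro: exI[of _ "-1"])
    have "((\<lambda>t. inverse t ^ m / exp (inverse t :: real)) \<longlongrightarrow> 0) (at_right 0)"
      by (rule filterlim_compose[OF tendsto_power_div_exp_0 filterlim_inverse_at_top_right])
    then show "(h m \<longlongrightarrow> 0) (at_right 0)"
      by (rule Lim_transform_eventually)
        (auto simp: h_def eventually_at_right_field exp_minus field_simps intro: exI[of _ 1])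
  qed
  have D: "(h m has_real_derivative (h (m + 2) t - real m * h (m + 1) t)) (at t)" for m t
  proof (cases t "0 :: real" rule: linorder_cases)
    case less
    have "((\<lambda>_. 0) has_real_derivative 0) (at t)"
      by simp
    then have "(h m has_real_derivative 0) (at t)"
      by (rule DERIV_cong_ev[THEN iffD1, rotated -1])
        (use eventually_nhds_in_open[of "{..<0}" t] less in \<open>auto simp: h_def elim: eventually_mono\<close>)
    then show ?thesis using less by (simp add: h_def)
  next
    case equal
    \<comment> \<open>At 0 the difference quotient of \<open>h m\<close> is
      \<open>h (m + 1)\<close>, which tends to 0 by \<open>lim\<close>.\<close>
    have "((\<lambda>s. (h m s - h m 0) / (s - 0)) \<longlongrightarrow> 0) (at 0)"
      by (rule Lim_transform_eventually[OF lim[of "m + 1"]])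
        (auto simp: h_def eventually_at_filter divide_inverse)
    then show ?thesis
      using equal by (simp add: h_def has_field_derivative_iff)
  next
    case greater
    have "((\<lambda>t. exp (- inverse t) * inverse t ^ m) has_real_derivative
        exp (- inverse t) * inverse t ^ (m + 2) - real m * (exp (- inverse t) * inverse t ^ (m + 1))) (at t)"
    proof (rule DERIV_cong)
      have inv: "(inverse has_real_derivative - (inverse t ^ Suc (Suc 0))) (at t)"
        using greater by (intro DERIV_inverse) simp
      show "((\<lambda>t. exp (- inverse t) * inverse t ^ m) has_real_derivative
          exp (- inverse t) * (inverse t ^ Suc (Suc 0)) * inverse t ^ m +
          real m * (- (inverse t ^ Suc (Suc 0)) * inverse t ^ (m - Suc 0)) * exp (- inverse t)) (at t)"
        using DERIV_mult[OF DERIV_fun_exp[OF DERIV_minus[OF inv]] DERIV_power[OF inv, of m]]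
        by simp
    \<comment> \<open>For m = 0 the truncated exponent \<open>m - Suc 0\<close> is harmless, since
      its factor \<open>real m\<close> is 0.\<close>
    qed (cases m; simp add: algebra_simps)
    then have "(h m has_real_derivative
        exp (- inverse t) * inverse t ^ (m + 2) - real m * (exp (- inverse t) * inverse t ^ (m + 1))) (at t)"
      by (rule DERIV_cong_ev[THEN iffD1, rotated -1])
        (use eventually_nhds_in_open[of "{0<..}" t] greater in \<open>auto simp: h_def elim: eventually_mono\<close>)
    then show ?thesis using greater by (simp add: h_def)
  qed
  show ?thesis
  proof (induction k arbitrary: m)
    case 0
    show ?case
      unfolding Ck_on.simps by (rule DERIV_continuous_on[OF D])
  next
    case (Suc k)
    show ?case
    proof (rule Ck_on_SucI)
      show "(h m has_derivative (\<lambda>b. (h (m + 2) t + (- real m) * h (m + 1) t) * b)) (at t)" for t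
        using D[of m t] by (simp add: has_field_derivative_def)
      show "Ck_on k UNIV (\<lambda>t. (h (m + 2) t + (- real m) * h (m + 1) t) * b)" for b
        using Suc.IH
        by (intro Ck_on_mult[OF open_UNIV] Ck_on_add[OF open_UNIV] Ck_on_const) simp_all
    qed simp
  qed
qed

section \<open>Integrals along rays and Hadamard's lemma\<close>

lemma ray_in_ball:
  fixes a :: "'e::real_normed_vector"
  assumes "x \<in> ball a r" "t \<in> {0..1}"
  shows "a + t *\<^sub>R (x - a) \<in> ball a r"
proof -
  have "norm (t *\<^sub>R (x - a)) \<le> 1 * norm (x - a)"
    unfolding norm_scaleR using assms(2) by (intro mult_right_mono) auto
  then show ?thesis
    using assms(1) by (simp add: dist_norm norm_minus_commute)
qed

text \<open>Each differentiation under the integral sign brings out a factor t from the inner map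
  \<open>a + t *\<^sub>R (x - a)\<close>, so the induction has to run over all weights
  \<open>t ^ m\<close>.\<close>

lemma Ck_on_ray_integral:
  fixes F :: "'e::euclidean_space \<Rightarrow> real" and a :: 'e
  shows "Ck_on k (ball a r) F \<Longrightarrow>
    Ck_on k (ball a r) (\<lambda>x. integral {0..1} (\<lambda>t. t ^ m * F (a + t *\<^sub>R (x - a))))"
proof (induction k arbitrary: m F)
  have ray_cont: "continuous_on (ball a r \<times> {0..1}) (\<lambda>(x, t). t ^ m * F (a + t *\<^sub>R (x - a)))"
    if "continuous_on (ball a r) F" for m and F :: "'e \<Rightarrow> real"
    unfolding case_prod_beta
    by (intro continuous_intros continuous_on_compose2[OF that]) (auto intro!: ray_in_ball simp del: mem_ball)
  {
    case 0
    then show ?case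
      using integral_continuous_on_param[of "ball a r" 0 1 "\<lambda>x t. t ^ m * F (a + t *\<^sub>R (x - a))"] ray_cont
      by simp
  next
    case (Suc k)
    define P where "P b y = frechet_derivative F (at y) b" for b y
    have contP: "continuous_on (ball a r) (P b)" if "b \<in> Basis" for b
      using Suc.prems that unfolding P_def by (intro Ck_on_imp_continuous_on[of k]) simp
    \<comment> \<open>The derivative of the integrand in x, as the bounded linear map that
      \<open>leibniz_rule\<close> expects. In basis form its integral is a combination of integrals
      of the same kind with weight \<open>t ^ Suc m\<close>.\<close>
    define fx where "fx x t = (\<Sum>b\<in>Basis. (t ^ Suc m * P b (a + t *\<^sub>R (x - a))) *\<^sub>R blinfun_inner_left b)"
      for x and t :: real
    have fx_cont: "continuous_on (ball a r \<times> {0..1}) (\<lambda>(x, t). fx x t)"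
      using ray_cont[OF contP, of _ "Suc m"] unfolding fx_def case_prod_beta
      by (intro continuous_on_sum continuous_on_scaleR continuous_on_const) simp
    have fx_apply: "blinfun_apply (fx x t) h = (\<Sum>b\<in>Basis. (t ^ Suc m * P b (a + t *\<^sub>R (x - a))) * (h \<bullet> b))" for x t h
      unfolding fx_def by (simp add: blinfun.sum_left blinfun.scaleR_left)
    have D: "((\<lambda>x. t ^ m * F (a + t *\<^sub>R (x - a))) has_derivative blinfun_apply (fx x t)) (at x within ball a r)"
      if x: "x \<in> ball a r" and t: "t \<in> {0..1}" for x t
    proof -
      let ?y = "a + t *\<^sub>R (x - a)"
      have DF: "(F has_derivative frechet_derivative F (at ?y)) (at ?y)"
        by (rule Ck_on_Suc_has_derivative[OF Suc.prems ray_in_ball[OF x t]])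
      have lin: "linear (frechet_derivative F (at ?y))"
        using DF by (rule has_derivative_linear)
      have "((\<lambda>x. a + t *\<^sub>R (x - a)) has_derivative (\<lambda>h. t *\<^sub>R h)) (at x)"
        by (auto intro!: derivative_eq_intros)
      from has_derivative_compose[OF this DF]
      have "((\<lambda>x. t ^ m * F (a + t *\<^sub>R (x - a))) has_derivative
          (\<lambda>h. t ^ m * frechet_derivative F (at ?y) (t *\<^sub>R h))) (at x)"
        by (rule has_derivative_mult_right)
      also have "(\<lambda>h. t ^ m * frechet_derivative F (at ?y) (t *\<^sub>R h)) = blinfun_apply (fx x t)"
      proof
        fix h
        have "frechet_derivative F (at ?y) (\<Sum>b\<in>Basis. (h \<bullet> b) *\<^sub>R b) = (\<Sum>b\<in>Basis. (h \<bullet> b) * P b ?y)"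
          unfolding P_def by (simp only: linear_sum[OF lin] linear_scale[OF lin] real_scaleR_def)
        then have "frechet_derivative F (at ?y) h = (\<Sum>b\<in>Basis. (h \<bullet> b) * P b ?y)"
          by (simp only: euclidean_representation)
        then show "t ^ m * frechet_derivative F (at ?y) (t *\<^sub>R h) = blinfun_apply (fx x t) h"
          unfolding fx_apply linear_scale[OF lin]
          by (simp add: sum_distrib_left mult_ac)
      qed
      finally show ?thesis by (rule has_derivative_at_withinI)
    qed
    have int: "(\<lambda>t. t ^ m * G (a + t *\<^sub>R (x - a))) integrable_on {0..1}"
      if "x \<in> ball a r" "continuous_on (ball a r) G" for x m and G :: "'e \<Rightarrow> real"
      using that by (intro integrable_continuous_real continuous_intros continuous_on_compose2[OF that(2)])
        (auto intro!: ray_in_ball simp del: mem_ball)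
    show ?case
    proof (rule Ck_on_SucI)
      fix x assume x: "x \<in> ball a r"
      have fxint: "fx x integrable_on {0..1}"
      proof (rule integrable_continuous_real)
        have "continuous_on {0..1} (\<lambda>t. (x, t))"
          by (intro continuous_intros)
        moreover have "(\<lambda>t. (x, t)) ` {0..1} \<subseteq> ball a r \<times> {0..1::real}"
          using x by auto
        ultimately show "continuous_on {0..1} (fx x)"
          using continuous_on_compose2[OF fx_cont, of "{0..1}" "\<lambda>t. (x, t)"] by simp
      qed
      have fx_integral: "blinfun_apply (integral {0..1} (fx x)) h =
          (\<Sum>b\<in>Basis. integral {0..1} (\<lambda>t. t ^ Suc m * P b (a + t *\<^sub>R (x - a))) * (h \<bullet> b))" for h
        unfolding blinfun_apply_integral[OF fxint] fx_apply
        by (rule integral_unique)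
          (rule has_integral_sum[OF finite_Basis has_integral_mult_left[OF integrable_integral[OF int[OF x contP]]]])
      have "((\<lambda>x. integral (cbox 0 1) (\<lambda>t. t ^ m * F (a + t *\<^sub>R (x - a)))) has_derivative
          blinfun_apply (integral (cbox 0 1) (fx x))) (at x within ball a r)"
      proof (rule leibniz_rule)
        show "((\<lambda>x. t ^ m * F (a + t *\<^sub>R (x - a))) has_derivative blinfun_apply (fx x t)) (at x within ball a r)"
          if "x \<in> ball a r" "t \<in> cbox 0 1" for x t
          using D that by simp
        show "(\<lambda>t. t ^ m * F (a + t *\<^sub>R (x - a))) integrable_on cbox 0 1" if "x \<in> ball a r" for x
          using int[OF that Ck_on_imp_continuous_on[OF Suc.prems]] by simp
        show "continuous_on (ball a r \<times> cbox 0 1) (\<lambda>(x, t). fx x t)"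
          using fx_cont by simp
      qed (use x in simp_all)
      moreover have "blinfun_apply (integral {0..1} (fx x)) =
          (\<lambda>h. \<Sum>b\<in>Basis. integral {0..1} (\<lambda>t. t ^ Suc m * P b (a + t *\<^sub>R (x - a))) * (h \<bullet> b))"
        by (rule ext) (rule fx_integral)
      ultimately show "((\<lambda>x. integral {0..1} (\<lambda>t. t ^ m * F (a + t *\<^sub>R (x - a)))) has_derivative
          (\<lambda>h. \<Sum>b\<in>Basis. integral {0..1} (\<lambda>t. t ^ Suc m * P b (a + t *\<^sub>R (x - a))) * (h \<bullet> b))) (at x)"
        using at_within_open[OF x open_ball] by (simp del: power_Suc)
    next
      fix c :: 'e
      have IH: "Ck_on k (ball a r) (\<lambda>x. integral {0..1} (\<lambda>t. t ^ Suc m * P b (a + t *\<^sub>R (x - a))))"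
        if "b \<in> Basis" for b
        using Suc.prems that unfolding P_def
        by (intro Suc.IH[where F = "\<lambda>y. frechet_derivative F (at y) b" and m = "Suc m"]) simp
      show "Ck_on k (ball a r) (\<lambda>x. \<Sum>b\<in>Basis.
          integral {0..1} (\<lambda>t. t ^ Suc m * P b (a + t *\<^sub>R (x - a))) * (c \<bullet> b))"
        by (intro Ck_on_sum[OF open_ball] Ck_on_mult[OF open_ball] Ck_on_const IH)
    qed simp
  }
qed

text \<open>The fundamental theorem of calculus along the segment from \<open>a\<close> to
  \<open>x\<close>: each coefficient is the mean of a partial derivative over the segment. At x = a
  the segment is a point, whence the value \<open>G b a\<close>.\<close>

lemma Hadamard:
  fixes F :: "'e::euclidean_space \<Rightarrow> real"
  assumes F: "smooth_on (ball a r) F" and r: "r > 0"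
  obtains G where "\<And>b. b \<in> Basis \<Longrightarrow> smooth_on (ball a r) (G b)"
    "\<And>b. b \<in> Basis \<Longrightarrow> G b a = frechet_derivative F (at a) b"
    "\<And>x. x \<in> ball a r \<Longrightarrow> F x = F a + (\<Sum>b\<in>Basis. ((x - a) \<bullet> b) * G b x)"
proof
  \<comment> \<open>The factor \<open>t ^ 0\<close> exhibits this as the case m = 0 of
    \<open>Ck_on_ray_integral\<close>.\<close>
  let ?G = "\<lambda>b x. integral {0..1} (\<lambda>t. t ^ 0 * frechet_derivative F (at (a + t *\<^sub>R (x - a))) b)"
  have Ck: "Ck_on k (ball a r) (\<lambda>y. frechet_derivative F (at y) b)" if "b \<in> Basis" for b k
    using F[unfolded smooth_on_def, rule_format, of "Suc k"] that by simp
  show "smooth_on (ball a r) (?G b)" if "b \<in> Basis" for b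
    unfolding smooth_on_def by (intro allI Ck_on_ray_integral Ck that)
  show "?G b a = frechet_derivative F (at a) b" for b
    by simp
  fix x assume x: "x \<in> ball a r"
  note ray = ray_in_ball[OF x]
  let ?d = "\<lambda>t. frechet_derivative F (at (a + t *\<^sub>R (x - a)))"
  have D: "((\<lambda>t. F (a + t *\<^sub>R (x - a))) has_vector_derivative ?d t (x - a)) (at t within {0..1})"
    if t: "t \<in> {0..1}" for t
  proof -
    have DF: "(F has_derivative ?d t) (at (a + t *\<^sub>R (x - a)))"
      using F[unfolded smooth_on_def, rule_format, of "Suc 0"]
      by (rule Ck_on_Suc_has_derivative) (rule ray[OF t])
    have "((\<lambda>t. a + t *\<^sub>R (x - a)) has_derivative (\<lambda>h. h *\<^sub>R (x - a))) (at t)"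
      by (auto intro!: derivative_eq_intros)
    from has_derivative_compose[OF this DF] show ?thesis
      unfolding has_vector_derivative_def linear_scale[OF has_derivative_linear[OF DF]]
      by (rule has_derivative_at_withinI)
  qed
  have expand: "?d t (x - a) = (\<Sum>b\<in>Basis. ((x - a) \<bullet> b) * ?d t b)" if t: "t \<in> {0..1}" for t
  proof -
    have lin: "linear (?d t)"
      using F[unfolded smooth_on_def, rule_format, of "Suc 0"] ray[OF t]
      by (intro has_derivative_linear[OF Ck_on_Suc_has_derivative])
    have "?d t (\<Sum>b\<in>Basis. ((x - a) \<bullet> b) *\<^sub>R b) = (\<Sum>b\<in>Basis. ((x - a) \<bullet> b) * ?d t b)"
      by (simp only: linear_sum[OF lin] linear_scale[OF lin] real_scaleR_def)
    then show ?thesis by (simp only: euclidean_representation)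
  qed
  have int: "((\<lambda>t. ?d t b) has_integral integral {0..1} (\<lambda>t. ?d t b)) {0..1}" if b: "b \<in> Basis" for b
  proof (rule integrable_integral, rule integrable_continuous_real)
    show "continuous_on {0..1} (\<lambda>t. ?d t b)"
      by (rule continuous_on_compose2[OF Ck[OF b, of 0, simplified]])
        (auto intro!: continuous_intros ray simp del: mem_ball)
  qed
  have "((\<lambda>t. ?d t (x - a)) has_integral F (a + 1 *\<^sub>R (x - a)) - F (a + 0 *\<^sub>R (x - a))) {0..1}"
    using D by (intro fundamental_theorem_of_calculus) auto
  moreover have "((\<lambda>t. ?d t (x - a)) has_integral (\<Sum>b\<in>Basis. ((x - a) \<bullet> b) * integral {0..1} (\<lambda>t. ?d t b))) {0..1}"
    by (rule has_integral_eq[OF expand[symmetric]])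
      (assumption, intro has_integral_sum has_integral_mult_right int finite_Basis)
  ultimately have "F (a + 1 *\<^sub>R (x - a)) - F (a + 0 *\<^sub>R (x - a)) =
      (\<Sum>b\<in>Basis. ((x - a) \<bullet> b) * integral {0..1} (\<lambda>t. ?d t b))"
    by (rule has_integral_unique)
  then show "F x = F a + (\<Sum>b\<in>Basis. ((x - a) \<bullet> b) * ?G b x)"
    by simp
qed

section \<open>Smooth functions on a manifold\<close>

lemma smooth_onD: "smooth_on S f \<Longrightarrow> Ck_on k S f"
  by (simp add: smooth_on_def)

lemma smooth_on_frechet_derivative:
  assumes "smooth_on S f" "b \<in> Basis"
  shows "smooth_on S (\<lambda>x. frechet_derivative f (at x) b)"
  using assms unfolding smooth_on_def by (metis Ck_on.simps(2))

lemma smooth_on_has_derivative: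
  "smooth_on S f \<Longrightarrow> x \<in> S \<Longrightarrow> (f has_derivative frechet_derivative f (at x)) (at x)"
  by (rule Ck_on_Suc_has_derivative[OF smooth_onD])

lemma smooth_on_coordinate:
  assumes "open S"
  shows "smooth_on S (\<lambda>x::'e::euclidean_space. (x - a) \<bullet> b)"
proof -
  have "Ck_on k S (\<lambda>x. (x + (- a)) \<bullet> b)" for k
    by (intro Ck_on_bounded_linear[OF bounded_linear_inner_left assms, where f = "\<lambda>x. x + (- a)"]
        Ck_on_add[OF assms Ck_on_ident[OF assms] Ck_on_const])
  then show ?thesis by (simp add: smooth_on_def)
qed

text \<open>The flat function is composed with r^2 - |x - a|^2, which is positive exactly inside the
  ball, and divided by its value at the centre. The squared norm is written in coordinates so that
  the closure rules for sums and products apply.\<close>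

lemma smooth_bump:
  fixes a :: "'e::euclidean_space"
  assumes "r > 0"
  obtains \<rho> :: "'e \<Rightarrow> real"
  where "smooth_on UNIV \<rho>" "\<rho> a = 1" "\<And>x. x \<notin> ball a r \<Longrightarrow> \<rho> x = 0"
proof
  let ?h = "\<lambda>t::real. if t > 0 then exp (- inverse t) * inverse t ^ 0 else 0"
  let ?q = "\<lambda>x. r\<^sup>2 + (- 1) * (\<Sum>b\<in>Basis. ((x - a) \<bullet> b) * ((x - a) \<bullet> b))"
  let ?\<rho> = "\<lambda>x. inverse (?h (r\<^sup>2)) * ?h (?q x)"
  have q: "?q x = r\<^sup>2 - (norm (x - a))\<^sup>2" for x
    by (simp add: power2_norm_eq_inner flip: euclidean_inner)
  have "Ck_on k UNIV ?q" for k
    by (intro Ck_on_add[OF open_UNIV] Ck_on_mult[OF open_UNIV] Ck_on_sum[OF open_UNIV] Ck_on_const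
        smooth_onD[OF smooth_on_coordinate[OF open_UNIV]])
  then have "Ck_on k UNIV (\<lambda>x. ?h (?q x))" for k
    by (rule Ck_on_compose[OF open_UNIV open_UNIV subset_UNIV _ smooth_flat_exp])
  then show "smooth_on UNIV ?\<rho>"
    unfolding smooth_on_def by (intro allI Ck_on_mult[OF open_UNIV Ck_on_const])
  show "?\<rho> a = 1"
    using assms by simp
  fix x assume "x \<notin> ball a r"
  then have "r \<le> norm (x - a)"
    by (simp add: dist_norm norm_minus_commute)
  then have "\<not> ?q x > 0"
    unfolding q using assms power_mono[of r "norm (x - a)" 2] by linarith
  then show "?\<rho> x = 0" by (simp only: if_False mult_zero_right)
qed

lemma smooth_manifold_charts:
  assumes "smooth_manifold A" "(U, \<psi>) \<in> A"
  shows "open U" "open (\<psi> ` U)" "homeomorphism U (\<psi> ` U) \<psi> (inv_into U \<psi>)" "inj_on \<psi> U"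
    "continuous_on U \<psi>" "continuous_on (\<psi> ` U) (inv_into U \<psi>)"
proof -
  have "is_chart (U, \<psi>)"
    using assms unfolding smooth_manifold_def by blast
  then show "open U" "open (\<psi> ` U)" and hom: "homeomorphism U (\<psi> ` U) \<psi> (inv_into U \<psi>)"
    by (simp_all add: is_chart_def)
  show "inj_on \<psi> U"
    using hom by (metis homeomorphism_def inj_on_inverseI)
  show "continuous_on U \<psi>" "continuous_on (\<psi> ` U) (inv_into U \<psi>)"
    using hom by (simp_all add: homeomorphism_def)
qed

lemma open_chart_image:
  assumes "smooth_manifold A" "(U, \<psi>) \<in> A" "open S"
  shows "open (\<psi> ` (U \<inter> S))"
proof -
  note c = smooth_manifold_charts[OF assms(1,2)]
  have "openin (top_of_set (\<psi> ` U)) (\<psi> ` (U \<inter> S))"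
    using homeomorphism_imp_open_map[OF c(3)] assms(3) by blast
  then show ?thesis
    using c(2) openin_open_eq by blast
qed

lemma smooth_funs_smooth_on:
  "f \<in> smooth_funs A \<Longrightarrow> (U, \<psi>) \<in> A \<Longrightarrow> smooth_on (\<psi> ` U) (f \<circ> inv_into U \<psi>)"
  unfolding smooth_funs_def by blast

lemma smooth_funs_const: "(\<lambda>_. c) \<in> smooth_funs A"
  by (auto simp: smooth_funs_def smooth_on_def o_def Ck_on_const)

lemma smooth_funs_add:
  assumes "smooth_manifold A" "f \<in> smooth_funs A" "g \<in> smooth_funs A"
  shows "f + g \<in> smooth_funs A"
proof -
  have "Ck_on k (\<psi> ` U) ((f + g) \<circ> inv_into U \<psi>)" if "(U, \<psi>) \<in> A" for U \<psi> k
    using Ck_on_add[OF smooth_manifold_charts(2)[OF assms(1) that]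
        smooth_onD[OF smooth_funs_smooth_on[OF assms(2) that]]
        smooth_onD[OF smooth_funs_smooth_on[OF assms(3) that]]]
    by (simp add: o_def)
  then show ?thesis unfolding smooth_funs_def smooth_on_def by blast
qed

lemma smooth_funs_mult:
  assumes "smooth_manifold A" "f \<in> smooth_funs A" "g \<in> smooth_funs A"
  shows "f * g \<in> smooth_funs A"
proof -
  have "Ck_on k (\<psi> ` U) ((f * g) \<circ> inv_into U \<psi>)" if "(U, \<psi>) \<in> A" for U \<psi> k
    using Ck_on_mult[OF smooth_manifold_charts(2)[OF assms(1) that]
        smooth_onD[OF smooth_funs_smooth_on[OF assms(2) that]]
        smooth_onD[OF smooth_funs_smooth_on[OF assms(3) that]]]
    by (simp add: o_def)
  then show ?thesis unfolding smooth_funs_def smooth_on_def by blast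
qed

lemma smooth_funs_scaleR:
  assumes "smooth_manifold A" "f \<in> smooth_funs A"
  shows "c *\<^sub>R f \<in> smooth_funs A"
proof -
  have "c *\<^sub>R f = (\<lambda>_. c) * f"
    by (simp add: fun_eq_iff scaleR_fun_def)
  then show ?thesis
    using smooth_funs_mult[OF assms(1) smooth_funs_const assms(2), of c] by simp
qed

lemma smooth_funs_sum:
  assumes "smooth_manifold A" "\<And>i. i \<in> I \<Longrightarrow> f i \<in> smooth_funs A"
  shows "(\<Sum>i\<in>I. f i) \<in> smooth_funs A"
  using assms(2)
proof (induction I rule: infinite_finite_induct)
  case (insert i I)
  then show ?case
    unfolding sum.insert[OF insert.hyps] by (intro smooth_funs_add[OF assms(1)]) simp_all
qed (use smooth_funs_const[of 0] in \<open>simp_all add: zero_fun_def\<close>)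

text \<open>Every chart domain is covered by two open pieces: the points that \<open>\<psi>\<close>
  sends into \<open>W\<close>, where the function is \<open>u\<close> read through the transition
  map because \<open>u\<close> vanishes on \<open>W - K\<close>, and the complement of the compact
  set corresponding to \<open>K\<close>, where it is 0.\<close>

lemma smooth_funs_extend_by_zero:
  fixes A :: "('a::{t2_space,second_countable_topology}, 'e::euclidean_space) chart set"
  assumes A: "smooth_manifold A" and c: "(U, \<psi>) \<in> A"
    and K: "compact K" "K \<subseteq> W" and W: "open W" "W \<subseteq> \<psi> ` U"
    and u: "smooth_on W u" "\<And>x. x \<in> W - K \<Longrightarrow> u x = 0"
  shows "(\<lambda>q. if q \<in> U \<and> \<psi> q \<in> K then u (\<psi> q) else 0) \<in> smooth_funs A"
proof -
  let ?f = "\<lambda>q. if q \<in> U \<and> \<psi> q \<in> K then u (\<psi> q) else 0"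
  note c' = smooth_manifold_charts[OF A c]
  have "Ck_on k (\<theta> ` V) (?f \<circ> inv_into V \<theta>)" if d: "(V, \<theta>) \<in> A" for V \<theta> k
  proof -
    note d' = smooth_manifold_charts[OF A d]
    let ?P = "U \<inter> \<psi> -` W" and ?K = "inv_into U \<psi> ` K"
    have "open ?P"
      using continuous_open_preimage[OF c'(5,1) W(1)] .
    have "compact ?K"
      using c'(6) K W(2) by (intro compact_continuous_image) (auto intro: continuous_on_subset)
    \<comment> \<open>Compact sets are closed because the manifold is Hausdorff. This settles
      smoothness at the boundary of \<open>U\<close>, where \<open>\<psi>\<close> gives no
      information.\<close>
    then have "open (- ?K)"
      using compact_imp_closed by blast
    have mem_K: "q \<in> ?K \<longleftrightarrow> q \<in> U \<and> \<psi> q \<in> K" for q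
      using K(2) W(2) c'(4) by (force simp: image_iff f_inv_into_f inv_into_f_f intro: inv_into_into)
    have open1: "open (\<theta> ` (V \<inter> ?P))" and open2: "open (\<theta> ` (V \<inter> - ?K))"
      using open_chart_image[OF A d] \<open>open ?P\<close> \<open>open (- ?K)\<close> by blast+
    have tr: "smooth_on (\<theta> ` (V \<inter> U)) (\<psi> \<circ> inv_into V \<theta>)"
      using A c d unfolding smooth_manifold_def by blast
    have "Ck_on k (\<theta> ` (V \<inter> ?P)) (\<lambda>y. u ((\<psi> \<circ> inv_into V \<theta>) y))"
    proof (rule Ck_on_compose[OF open1 W(1)])
      show "(\<psi> \<circ> inv_into V \<theta>) ` \<theta> ` (V \<inter> ?P) \<subseteq> W"
        using d'(4) by (auto simp: inv_into_f_f)
      show "Ck_on k (\<theta> ` (V \<inter> ?P)) (\<psi> \<circ> inv_into V \<theta>)"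
        by (rule Ck_on_subset[OF smooth_onD[OF tr]]) auto
      show "Ck_on k W u"
        by (rule smooth_onD[OF u(1)])
    qed
    then have 1: "Ck_on k (\<theta> ` (V \<inter> ?P)) (?f \<circ> inv_into V \<theta>)"
      by (rule Ck_on_cong[OF open1, rotated])
        (use d'(4) u(2) in \<open>auto simp: inv_into_f_f\<close>)
    have 2: "Ck_on k (\<theta> ` (V \<inter> - ?K)) (?f \<circ> inv_into V \<theta>)"
      by (rule Ck_on_cong[OF open2 _ Ck_on_const[where c = 0]])
        (use d'(4) mem_K in \<open>auto simp: inv_into_f_f\<close>)
    have "\<theta> ` V = \<theta> ` (V \<inter> ?P) \<union> \<theta> ` (V \<inter> - ?K)"
      using mem_K K(2) by blast
    then show ?thesis
      using Ck_on_Un[OF open1 open2 1 2] by simp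
  qed
  then show ?thesis unfolding smooth_funs_def smooth_on_def by blast
qed

section \<open>Tangent vectors extend to vector fields\<close>

lemma tangent_spaceD:
  assumes "v \<in> tangent_space A p"
  shows "f \<in> smooth_funs A \<Longrightarrow> g \<in> smooth_funs A \<Longrightarrow> v (f + g) = v f + v g"
    and "f \<in> smooth_funs A \<Longrightarrow> v (c *\<^sub>R f) = c * v f"
    and "f \<in> smooth_funs A \<Longrightarrow> g \<in> smooth_funs A \<Longrightarrow> v (f * g) = f p * v g + g p * v f"
    and "f \<notin> smooth_funs A \<Longrightarrow> v f = 0"
  using assms unfolding tangent_space_def by blast+

text \<open>The Leibniz rule applied to 1 * 1 = 1 gives v(1) = 2 v(1).\<close>

lemma tangent_vector_const:
  assumes "v \<in> tangent_space A p"
  shows "v (\<lambda>_. c) = 0"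
proof -
  have "v ((\<lambda>_. 1) * (\<lambda>_. 1)) = 1 * v (\<lambda>_. 1) + 1 * v (\<lambda>_. 1)"
    by (rule tangent_spaceD(3)[OF assms smooth_funs_const smooth_funs_const])
  then have "v (\<lambda>_. 1) = 0" by (simp add: times_fun_def)
  moreover have "v (c *\<^sub>R (\<lambda>_. 1)) = c * v (\<lambda>_. 1)"
    by (rule tangent_spaceD(2)[OF assms smooth_funs_const])
  ultimately show ?thesis by (simp add: scaleR_fun_def)
qed

lemma tangent_vector_sum:
  assumes "smooth_manifold A" "v \<in> tangent_space A p" "\<And>i. i \<in> I \<Longrightarrow> f i \<in> smooth_funs A"
  shows "v (\<Sum>i\<in>I. f i) = (\<Sum>i\<in>I. v (f i))"
  using assms(3)
proof (induction I rule: infinite_finite_induct)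
  case (insert i I)
  then have "v (f i + sum f I) = v (f i) + v (sum f I)"
    by (intro tangent_spaceD(1)[OF assms(2)] smooth_funs_sum[OF assms(1)]) simp_all
  moreover have "v (sum f I) = (\<Sum>i\<in>I. v (f i))"
    using insert.prems by (intro insert.IH) simp
  ultimately show ?case
    by (simp only: sum.insert[OF insert.hyps])
qed (use tangent_vector_const[OF assms(2), of 0] in \<open>simp_all add: zero_fun_def\<close>)

lemma tangent_space_zero: "0 \<in> tangent_space A p"
  by (simp add: tangent_space_def)

lemma tangent_space_add:
  "u \<in> tangent_space A p \<Longrightarrow> v \<in> tangent_space A p \<Longrightarrow> u + v \<in> tangent_space A p"
  unfolding tangent_space_def by (auto simp: algebra_simps)

lemma tangent_space_scaleR: "v \<in> tangent_space A p \<Longrightarrow> c *\<^sub>R v \<in> tangent_space A p"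
  unfolding tangent_space_def by (auto simp: scaleR_fun_def algebra_simps)

lemma tangent_space_diff:
  "u \<in> tangent_space A p \<Longrightarrow> v \<in> tangent_space A p \<Longrightarrow> u - v \<in> tangent_space A p"
  using tangent_space_add[of u A p "(- 1) *\<^sub>R v"] tangent_space_scaleR[of v A p "- 1"]
  by (simp only: scaleR_minus1_left diff_conv_add_uminus)

lemma tangent_space_sum:
  "(\<And>i. i \<in> I \<Longrightarrow> f i \<in> tangent_space A p) \<Longrightarrow> (\<Sum>i\<in>I. f i) \<in> tangent_space A p"
proof (induction I rule: infinite_finite_induct)
  case (insert i I)
  show ?case
    unfolding sum.insert[OF insert.hyps]
    by (intro tangent_space_add insert.IH insert.prems) simp_all
qed (simp_all add: tangent_space_zero)

lemma sum_fun_apply: "(\<Sum>i\<in>I. f i) x = (\<Sum>i\<in>I. f i x :: 'b::comm_monoid_add)"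
  by (induction I rule: infinite_finite_induct) auto

text \<open>These are the coordinate vectors of a chart; the derivation laws are the rules for the
  derivative of the chart expression. The value 0 on nonsmooth functions is the one that
  \<open>tangent_space\<close> prescribes.\<close>

lemma coordinate_derivation_tangent:
  fixes A :: "('a::{t2_space,second_countable_topology}, 'e::euclidean_space) chart set"
  assumes A: "smooth_manifold A" and c: "(U, \<psi>) \<in> A" and q: "q \<in> U"
  shows "(\<lambda>f. if f \<in> smooth_funs A then frechet_derivative (f \<circ> inv_into U \<psi>) (at (\<psi> q)) b else 0)
    \<in> tangent_space A q"
proof -
  let ?d = "\<lambda>f. frechet_derivative (f \<circ> inv_into U \<psi>) (at (\<psi> q))"
  have D: "(f \<circ> inv_into U \<psi> has_derivative ?d f) (at (\<psi> q))" if "f \<in> smooth_funs A" for f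
    using smooth_on_has_derivative[OF smooth_funs_smooth_on[OF that c]] q by simp
  have inv: "inv_into U \<psi> (\<psi> q) = q"
    using smooth_manifold_charts(4)[OF A c] q by simp
  have "?d (f + g) = (\<lambda>h. ?d f h + ?d g h)" if "f \<in> smooth_funs A" "g \<in> smooth_funs A" for f g
    using frechet_derivative_at[OF has_derivative_add[OF D[OF that(1)] D[OF that(2)]]]
    by (simp add: o_def)
  moreover have "?d (f * g) = (\<lambda>h. f q * ?d g h + ?d f h * g q)"
    if "f \<in> smooth_funs A" "g \<in> smooth_funs A" for f g
    using frechet_derivative_at[OF has_derivative_mult[OF D[OF that(1)] D[OF that(2)]]]
    by (simp add: o_def inv)
  moreover have "?d (c *\<^sub>R f) = (\<lambda>h. c * ?d f h)" if "f \<in> smooth_funs A" for f c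
    using frechet_derivative_at[OF has_derivative_mult_right[OF D[OF that], of c]]
    by (simp add: o_def scaleR_fun_def)
  ultimately show ?thesis
    unfolding tangent_space_def
    using smooth_funs_add[OF A] smooth_funs_mult[OF A] smooth_funs_scaleR[OF A]
    by (auto simp del: plus_fun_apply times_fun_apply)
qed

text \<open>The extension is the coordinate field with constant coefficients
  \<open>v (coord b)\<close>, cut off by the bump function. Hadamard's expansion shows that at
  \<open>p\<close> it acts on every smooth function as \<open>v\<close> does.\<close>

lemma tangent_vector_extends:
  fixes A :: "('a::{t2_space,second_countable_topology}, 'e::euclidean_space) chart set"
  assumes A: "smooth_manifold A" and v: "v \<in> tangent_space A p"
  obtains X where "X \<in> vector_fields A" "X p = v"
proof -
  obtain U \<psi> where c: "(U, \<psi>) \<in> A" and p: "p \<in> U"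
    using A unfolding smooth_manifold_def by blast
  note c' = smooth_manifold_charts[OF A c]
  let ?a = "\<psi> p"
  obtain R where R: "R > 0" "ball ?a R \<subseteq> \<psi> ` U"
    using c'(2) p open_contains_ball[of "\<psi> ` U"] by blast
  \<comment> \<open>Two radii: the closed ball of radius \<open>r\<close> is a compact subset of the
    open ball of radius \<open>R\<close>, as extension by zero requires.\<close>
  define r where "r = R / 2"
  have r: "0 < r" "r < R" using R by (simp_all add: r_def)
  obtain \<rho> :: "'e \<Rightarrow> real" where \<rho>: "smooth_on UNIV \<rho>" "\<rho> ?a = 1"
    "\<And>x. x \<notin> ball ?a r \<Longrightarrow> \<rho> x = 0"
    using smooth_bump[OF r(1)] by blast
  define ext where "ext w q = (if q \<in> U \<and> \<psi> q \<in> cball ?a r then \<rho> (\<psi> q) * w (\<psi> q) else 0)" for w q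
  have ext_p: "ext w p = w ?a" for w
    using p r(1) \<rho>(2) by (simp add: ext_def)
  have ext_smooth: "ext w \<in> smooth_funs A" if w: "smooth_on (ball ?a R) w" for w
    unfolding ext_def
  proof (rule smooth_funs_extend_by_zero[OF A c compact_cball _ open_ball R(2)])
    show "cball ?a r \<subseteq> ball ?a R"
      using r(2) by auto
    have "Ck_on k (ball ?a R) (\<lambda>x. \<rho> x * w x)" for k
      using Ck_on_mult[OF open_ball Ck_on_subset[OF smooth_onD[OF \<rho>(1)] subset_UNIV] smooth_onD[OF w]] .
    then show "smooth_on (ball ?a R) (\<lambda>x. \<rho> x * w x)"
      by (simp add: smooth_on_def)
  qed (use \<rho>(3) in auto)
  define coord where "coord b = ext (\<lambda>x. (x - ?a) \<bullet> b)" for b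
  have coord: "coord b \<in> smooth_funs A" "coord b p = 0" for b
    using ext_smooth[OF smooth_on_coordinate[OF open_ball]] by (simp_all add: coord_def ext_p)
  have one: "ext (\<lambda>_. 1) \<in> smooth_funs A"
    by (rule ext_smooth) (simp add: smooth_on_def Ck_on_const)
  define d where "d q b = (\<lambda>f. if f \<in> smooth_funs A
      then frechet_derivative (f \<circ> inv_into U \<psi>) (at (\<psi> q)) b else 0)" for q b
  define X where "X q = (if q \<in> U \<and> \<psi> q \<in> cball ?a r
      then \<Sum>b\<in>Basis. (v (coord b) * \<rho> (\<psi> q)) *\<^sub>R d q b else 0)" for q
  have d_smooth: "smooth_on (ball ?a R) (\<lambda>x. frechet_derivative (f \<circ> inv_into U \<psi>) (at x) b)"
    if "f \<in> smooth_funs A" "b \<in> Basis" for f b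
    using smooth_on_frechet_derivative[OF smooth_funs_smooth_on[OF that(1) c] that(2)] R(2)
    unfolding smooth_on_def by (blast intro: Ck_on_subset[where S = "\<psi> ` U"])
  have X_apply: "(\<lambda>q. X q f) =
      (\<Sum>b\<in>Basis. v (coord b) *\<^sub>R ext (\<lambda>x. frechet_derivative (f \<circ> inv_into U \<psi>) (at x) b))"
    if "f \<in> smooth_funs A" for f
    using that by (auto simp: fun_eq_iff X_def d_def ext_def sum_fun_apply scaleR_fun_def mult.assoc)
  have "X q \<in> tangent_space A q" for q
    unfolding X_def d_def
    by (auto intro!: tangent_space_sum tangent_space_scaleR coordinate_derivation_tangent[OF A c] tangent_space_zero)
  moreover have "(\<lambda>q. X q f) \<in> smooth_funs A" if "f \<in> smooth_funs A" for f
    unfolding X_apply[OF that]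
    by (intro smooth_funs_sum[OF A] smooth_funs_scaleR[OF A] ext_smooth d_smooth that)
  ultimately have "X \<in> vector_fields A"
    unfolding vector_fields_def by blast
  moreover have "X p f = v f" for f
  proof (cases "f \<in> smooth_funs A")
    case False
    then show ?thesis
      using tangent_spaceD(4)[OF v] p r(1) by (simp add: X_def d_def sum_fun_apply scaleR_fun_def)
  next
    case f: True
    let ?F = "f \<circ> inv_into U \<psi>"
    have "smooth_on (ball ?a R) ?F"
      using smooth_funs_smooth_on[OF f c] R(2)
      unfolding smooth_on_def by (blast intro: Ck_on_subset[where S = "\<psi> ` U"])
    from Hadamard[OF this R(1)] obtain G where
      G: "\<And>b. b \<in> Basis \<Longrightarrow> smooth_on (ball ?a R) (G b)"
        "\<And>b. b \<in> Basis \<Longrightarrow> G b ?a = frechet_derivative ?F (at ?a) b"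
        "\<And>x. x \<in> ball ?a R \<Longrightarrow> ?F x = ?F ?a + (\<Sum>b\<in>Basis. ((x - ?a) \<bullet> b) * G b x)"
      by blast
    have inv: "inv_into U \<psi> (\<psi> q) = q" if "q \<in> U" for q
      using c'(4) that by simp
    have diff: "f + (\<lambda>_. - f p) \<in> smooth_funs A"
      by (intro smooth_funs_add[OF A f] smooth_funs_const)
    \<comment> \<open>On the right one factor of the bump function goes to the coordinate and the
      other to \<open>G b\<close>. Outside the closed ball both sides are 0.\<close>
    have decomp: "ext (\<lambda>_. 1) * (ext (\<lambda>_. 1) * (f + (\<lambda>_. - f p))) = (\<Sum>b\<in>Basis. coord b * ext (G b))"
    proof
      fix q
      show "(ext (\<lambda>_. 1) * (ext (\<lambda>_. 1) * (f + (\<lambda>_. - f p)))) q = (\<Sum>b\<in>Basis. coord b * ext (G b)) q"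
      proof (cases "q \<in> U \<and> \<psi> q \<in> cball ?a r")
        case True
        then have "\<psi> q \<in> ball ?a R" using r(2) by auto
        from G(3)[OF this] have "f q - f p = (\<Sum>b\<in>Basis. ((\<psi> q - ?a) \<bullet> b) * G b (\<psi> q))"
          using True p by (simp add: inv)
        then have "\<rho> (\<psi> q) * (\<rho> (\<psi> q) * (f q - f p)) =
            (\<Sum>b\<in>Basis. (\<rho> (\<psi> q) * ((\<psi> q - ?a) \<bullet> b)) * (\<rho> (\<psi> q) * G b (\<psi> q)))"
          by (simp add: sum_distrib_left mult_ac)
        then show ?thesis
          using True by (simp add: sum_fun_apply coord_def ext_def)
      qed (auto simp: sum_fun_apply ext_def coord_def)
    qed
    \<comment> \<open>The Leibniz rule is used twice: the cutoff is 1 at \<open>p\<close> and f -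
      f(p) vanishes there, so each cutoff factor drops out.\<close>
    have "v (ext (\<lambda>_. 1) * (ext (\<lambda>_. 1) * (f + (\<lambda>_. - f p)))) = v (f + (\<lambda>_. - f p))"
      by (simp only: tangent_spaceD(3)[OF v one smooth_funs_mult[OF A one diff]]
          tangent_spaceD(3)[OF v one diff] ext_p) (simp add: ext_p)
    also have "\<dots> = v f"
      using tangent_spaceD(1)[OF v f smooth_funs_const, of "- f p"] tangent_vector_const[OF v] by simp
    finally have "v f = v (\<Sum>b\<in>Basis. coord b * ext (G b))"
      by (simp only: decomp)
    also have "\<dots> = (\<Sum>b\<in>Basis. v (coord b * ext (G b)))"
      by (intro tangent_vector_sum[OF A v] smooth_funs_mult[OF A] coord ext_smooth G)
    \<comment> \<open>Since \<open>coord b\<close> vanishes at \<open>p\<close>, only the term that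
      differentiates it survives, with coefficient \<open>G b\<close> at the centre, the partial
      derivative.\<close>
    also have "\<dots> = (\<Sum>b\<in>Basis. v (coord b) * frechet_derivative ?F (at ?a) b)"
      using tangent_spaceD(3)[OF v coord(1) ext_smooth[OF G(1)]]
      by (intro sum.cong refl) (simp add: coord(2) ext_p G(2) mult.commute)
    also have "\<dots> = X p f"
      using p r(1) f \<rho>(2) by (simp add: X_def d_def sum_fun_apply scaleR_fun_def)
    finally show ?thesis ..
  qed
  ultimately show thesis
    using that by blast
qed

section \<open>Lie brackets of vector fields\<close>

lemma vector_fieldsD:
  assumes "X \<in> vector_fields A"
  shows "X p \<in> tangent_space A p" "f \<in> smooth_funs A \<Longrightarrow> (\<lambda>q. X q f) \<in> smooth_funs A"
  using assms unfolding vector_fields_def by blast+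

lemma lie_bracket_tangent:
  assumes A: "smooth_manifold A" and X: "X \<in> vector_fields A" and Y: "Y \<in> vector_fields A"
  shows "lie_bracket A X Y p \<in> tangent_space A p"
proof -
  have add: "Z p (\<lambda>q. W q (f + g)) = Z p (\<lambda>q. W q f) + Z p (\<lambda>q. W q g)"
    if "Z \<in> vector_fields A" "W \<in> vector_fields A" "f \<in> smooth_funs A" "g \<in> smooth_funs A" for Z W f g
  proof -
    have "(\<lambda>q. W q (f + g)) = (\<lambda>q. W q f) + (\<lambda>q. W q g)"
      using tangent_spaceD(1)[OF vector_fieldsD(1)[OF that(2)] that(3,4)] by (simp add: plus_fun_def)
    then show ?thesis
      using tangent_spaceD(1)[OF vector_fieldsD(1)[OF that(1)]] vector_fieldsD(2)[OF that(2)] that(3,4)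
      by simp
  qed
  have scale: "Z p (\<lambda>q. W q (c *\<^sub>R f)) = c * Z p (\<lambda>q. W q f)"
    if "Z \<in> vector_fields A" "W \<in> vector_fields A" "f \<in> smooth_funs A" for Z W f c
  proof -
    have "(\<lambda>q. W q (c *\<^sub>R f)) = c *\<^sub>R (\<lambda>q. W q f)"
      using tangent_spaceD(2)[OF vector_fieldsD(1)[OF that(2)] that(3)] by (simp add: scaleR_fun_def)
    then show ?thesis
      using tangent_spaceD(2)[OF vector_fieldsD(1)[OF that(1)]] vector_fieldsD(2)[OF that(2)] that(3)
      by simp
  qed
  \<comment> \<open>The two terms that differentiate both factors once are together symmetric in
    \<open>Z\<close> and \<open>W\<close>, so they cancel in the commutator.\<close>
  have mult: "Z p (\<lambda>q. W q (f * g)) =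
      f p * Z p (\<lambda>q. W q g) + W p g * Z p f + (g p * Z p (\<lambda>q. W q f) + W p f * Z p g)"
    if "Z \<in> vector_fields A" "W \<in> vector_fields A" "f \<in> smooth_funs A" "g \<in> smooth_funs A" for Z W f g
  proof -
    have eq: "(\<lambda>q. W q (f * g)) = f * (\<lambda>q. W q g) + g * (\<lambda>q. W q f)"
      using tangent_spaceD(3)[OF vector_fieldsD(1)[OF that(2)] that(3,4)]
      by (simp add: plus_fun_def times_fun_def)
    note Z = tangent_spaceD[OF vector_fieldsD(1)[OF that(1), of p]]
    note W = vector_fieldsD(2)[OF that(2)]
    show ?thesis
      unfolding eq
      by (simp only: Z(1)[OF smooth_funs_mult[OF A that(3) W[OF that(4)]]
            smooth_funs_mult[OF A that(4) W[OF that(3)]]]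
          Z(3)[OF that(3) W[OF that(4)]] Z(3)[OF that(4) W[OF that(3)]])
  qed
  show ?thesis
    unfolding tangent_space_def lie_bracket_def
    using smooth_funs_add[OF A] smooth_funs_mult[OF A] smooth_funs_scaleR[OF A]
    by (auto simp: add[OF X Y] add[OF Y X] scale[OF X Y] scale[OF Y X] mult[OF X Y] mult[OF Y X]
        algebra_simps simp del: plus_fun_apply times_fun_apply)
qed

lemma vector_fields_scaleR:
  assumes A: "smooth_manifold A" and X: "X \<in> vector_fields A"
  shows "(\<lambda>p. c *\<^sub>R X p) \<in> vector_fields A"
proof -
  have "(\<lambda>p. (c *\<^sub>R X p) f) \<in> smooth_funs A" if "f \<in> smooth_funs A" for f
    using smooth_funs_scaleR[OF A vector_fieldsD(2)[OF X that], of c] by (simp add: scaleR_fun_def)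
  then show ?thesis
    using tangent_space_scaleR[OF vector_fieldsD(1)[OF X]] unfolding vector_fields_def by blast
qed

lemma lie_bracket_scaleR_left:
  assumes X: "X \<in> vector_fields A" and Y: "Y \<in> vector_fields A"
  shows "lie_bracket A (\<lambda>p. c *\<^sub>R X p) Y p = c *\<^sub>R lie_bracket A X Y p"
proof
  fix f
  have "Y p (\<lambda>q. (c *\<^sub>R X q) f) = c * Y p (\<lambda>q. X q f)" if "f \<in> smooth_funs A"
    using tangent_spaceD(2)[OF vector_fieldsD(1)[OF Y] vector_fieldsD(2)[OF X that], where c = c]
    by (simp add: scaleR_fun_def)
  then show "lie_bracket A (\<lambda>p. c *\<^sub>R X p) Y p f = (c *\<^sub>R lie_bracket A X Y p) f"
    by (auto simp: lie_bracket_def scaleR_fun_def right_diff_distrib)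
qed

lemma lie_bracket_anticommute: "lie_bracket A X Y p = (- 1) *\<^sub>R lie_bracket A Y X p"
  by (auto simp: lie_bracket_def scaleR_fun_def fun_eq_iff)

lemma lie_bracket_scaleR_right:
  assumes "X \<in> vector_fields A" "Y \<in> vector_fields A"
  shows "lie_bracket A X (\<lambda>p. c *\<^sub>R Y p) p = c *\<^sub>R lie_bracket A X Y p"
  by (subst (1 2) lie_bracket_anticommute)
    (simp only: lie_bracket_scaleR_left[OF assms(2,1)] scaleR_scaleR mult.commute)

section \<open>Weak almost contact metric structures\<close>

lemma tensor_field11D:
  assumes "tensor_field11 A \<phi>"
  shows "v \<in> tangent_space A p \<Longrightarrow> \<phi> p v \<in> tangent_space A p"
    and "u \<in> tangent_space A p \<Longrightarrow> v \<in> tangent_space A p \<Longrightarrow>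
      \<phi> p (a *\<^sub>R u + b *\<^sub>R v) = a *\<^sub>R \<phi> p u + b *\<^sub>R \<phi> p v"
    and "v \<in> tangent_space A p \<Longrightarrow> \<phi> p (a *\<^sub>R v) = a *\<^sub>R \<phi> p v"
    and "X \<in> vector_fields A \<Longrightarrow> apply_field \<phi> X \<in> vector_fields A"
proof -
  show "\<phi> p (a *\<^sub>R u + b *\<^sub>R v) = a *\<^sub>R \<phi> p u + b *\<^sub>R \<phi> p v"
    if "u \<in> tangent_space A p" "v \<in> tangent_space A p" for u v a b
    using assms that unfolding tensor_field11_def by blast
  from this[of v v a 0] show "v \<in> tangent_space A p \<Longrightarrow> \<phi> p (a *\<^sub>R v) = a *\<^sub>R \<phi> p v"
    by (simp only: scaleR_zero_left add_0_right)
qed (use assms in \<open>unfold tensor_field11_def, blast+\<close>)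

section \<open>Scaling of (1,1)-tensor fields and of N1\<close>

lemma tensor_field11_scaleR:
  assumes A: "smooth_manifold A" and \<phi>: "tensor_field11 A \<phi>"
  shows "tensor_field11 A (\<lambda>p v. c *\<^sub>R \<phi> p v)"
  unfolding tensor_field11_def
proof (intro conjI allI ballI)
  show "c *\<^sub>R \<phi> p v \<in> tangent_space A p" if "v \<in> tangent_space A p" for p v
    by (intro tangent_space_scaleR tensor_field11D(1)[OF \<phi>] that)
  show "c *\<^sub>R \<phi> p (a *\<^sub>R u + b *\<^sub>R v) = a *\<^sub>R c *\<^sub>R \<phi> p u + b *\<^sub>R c *\<^sub>R \<phi> p v"
    if "u \<in> tangent_space A p" "v \<in> tangent_space A p" for p u v a b
    by (simp only: tensor_field11D(2)[OF \<phi> that] scaleR_add_right scaleR_scaleR mult.commute)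
  show "apply_field (\<lambda>p v. c *\<^sub>R \<phi> p v) X \<in> vector_fields A" if "X \<in> vector_fields A" for X
    using vector_fields_scaleR[OF A tensor_field11D(4)[OF \<phi> that], of c]
    by (simp add: apply_field_def)
qed

lemma tensor_field11_id: "tensor_field11 A id_field"
  by (simp add: tensor_field11_def id_field_def apply_field_def)

text \<open>Each term of the Nijenhuis tensor is quadratic in \<open>\<phi>\<close>, and the
  constant \<open>s\<close> passes through brackets. The remaining term scales by the same s * s
  through Q xi, because d eta does not involve \<open>\<phi>\<close>.\<close>

lemma tensor_N1_homothety:
  assumes A: "smooth_manifold A" and \<phi>': "tensor_field11 A \<phi>'"
    and \<phi>: "\<And>p v. v \<in> tangent_space A p \<Longrightarrow> \<phi> p v = s *\<^sub>R \<phi>' p v"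
    and Q: "Q p (\<xi> p) = (s * s) *\<^sub>R Q' p (\<xi> p)"
    and X: "X \<in> vector_fields A" and Y: "Y \<in> vector_fields A"
  shows "tensor_N1 A \<phi> Q \<xi> \<eta> X Y p = (s * s) *\<^sub>R tensor_N1 A \<phi>' Q' \<xi> \<eta> X Y p"
proof -
  have ap: "apply_field \<phi> Z = (\<lambda>p. s *\<^sub>R apply_field \<phi>' Z p)" if "Z \<in> vector_fields A" for Z
    using \<phi>[OF vector_fieldsD(1)[OF that]] by (simp add: apply_field_def)
  note X' = tensor_field11D(4)[OF \<phi>' X] and Y' = tensor_field11D(4)[OF \<phi>' Y]
  note T = lie_bracket_tangent[OF A] tensor_field11D(1)[OF \<phi>']
  have 1: "\<phi> p (\<phi> p (lie_bracket A X Y p)) = (s * s) *\<^sub>R \<phi>' p (\<phi>' p (lie_bracket A X Y p))"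
    by (simp only: \<phi>[OF T(1)[OF X Y]] \<phi>[OF tangent_space_scaleR[OF T(2)[OF T(1)[OF X Y]]]]
        tensor_field11D(3)[OF \<phi>' T(2)[OF T(1)[OF X Y]]] scaleR_scaleR)
  have 2: "lie_bracket A (apply_field \<phi> X) (apply_field \<phi> Y) p =
      (s * s) *\<^sub>R lie_bracket A (apply_field \<phi>' X) (apply_field \<phi>' Y) p"
    by (simp only: ap[OF X] ap[OF Y] lie_bracket_scaleR_left[OF X' vector_fields_scaleR[OF A Y']]
        lie_bracket_scaleR_right[OF X' Y'] scaleR_scaleR)
  have 3: "\<phi> p (lie_bracket A (apply_field \<phi> X) Y p) = (s * s) *\<^sub>R \<phi>' p (lie_bracket A (apply_field \<phi>' X) Y p)"
    by (simp only: ap[OF X] lie_bracket_scaleR_left[OF X' Y] \<phi>[OF tangent_space_scaleR[OF T(1)[OF X' Y]]]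
        tensor_field11D(3)[OF \<phi>' T(1)[OF X' Y]] scaleR_scaleR)
  have 4: "\<phi> p (lie_bracket A X (apply_field \<phi> Y) p) = (s * s) *\<^sub>R \<phi>' p (lie_bracket A X (apply_field \<phi>' Y) p)"
    by (simp only: ap[OF Y] lie_bracket_scaleR_right[OF X Y'] \<phi>[OF tangent_space_scaleR[OF T(1)[OF X Y']]]
        tensor_field11D(3)[OF \<phi>' T(1)[OF X Y']] scaleR_scaleR)
  show ?thesis
    unfolding tensor_N1_def nijenhuis_def 1 2 3 4 Q
    by (simp only: scaleR_add_right scaleR_diff_right scaleR_scaleR mult.commute)
qed

text \<open>The constant \<open>\<nu>\<close>, existential in the definition, is a parameter here,
  so that the given structure and a Sasakian one, with \<nu> = 1, are two instances.\<close>

locale weak_acm =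
  fixes A :: "('a::{t2_space,second_countable_topology}, 'e::euclidean_space) chart set"
    and \<phi> Q :: "'a endofield" and \<xi> :: "'a vfield" and \<eta> :: "'a oneform" and g :: "'a bilinfield"
    and \<nu> :: real
  assumes manifold: "smooth_manifold A"
    and acm: "weak_almost_contact_metric A \<phi> Q \<xi> \<eta> g"
    and \<nu>_pos: "\<nu> > 0"
    and Q_\<xi>: "Q p (\<xi> p) = \<nu> *\<^sub>R \<xi> p"
begin

section \<open>Pointwise identities of a weak almost contact metric structure\<close>

lemma tensor_\<phi>: "tensor_field11 A \<phi>" and tensor_Q: "tensor_field11 A Q"
  and nonsingular_Q: "nonsingular A Q" and \<xi>_field: "\<xi> \<in> vector_fields A"
  and one_form_\<eta>: "one_form A \<eta>" and metric_g: "riemannian_metric A g"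
  and \<eta>_\<xi>: "\<eta> p (\<xi> p) = 1"
  and \<phi>_sq: "v \<in> tangent_space A p \<Longrightarrow> \<phi> p (\<phi> p v) = - Q p v + \<eta> p v *\<^sub>R Q p (\<xi> p)"
  and \<phi>_kernel: "v \<in> kernel_distribution A \<eta> p \<Longrightarrow> \<phi> p v \<in> kernel_distribution A \<eta> p"
  and g_\<phi>_\<phi>: "u \<in> tangent_space A p \<Longrightarrow> v \<in> tangent_space A p \<Longrightarrow>
    g p (\<phi> p u) (\<phi> p v) = g p u (Q p v) - \<eta> p u * \<eta> p (Q p v)"
  using acm unfolding weak_almost_contact_metric_def weak_almost_contact_def by blast+

lemmas \<xi>_tangent = vector_fieldsD(1)[OF \<xi>_field]
lemmas \<phi>_tangent = tensor_field11D(1)[OF tensor_\<phi>]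
lemmas Q_tangent = tensor_field11D(1)[OF tensor_Q]

lemma \<eta>_linear:
  "u \<in> tangent_space A p \<Longrightarrow> v \<in> tangent_space A p \<Longrightarrow> \<eta> p (a *\<^sub>R u + b *\<^sub>R v) = a * \<eta> p u + b * \<eta> p v"
  using one_form_\<eta> unfolding one_form_def by blast

lemma \<eta>_scaleR: "v \<in> tangent_space A p \<Longrightarrow> \<eta> p (a *\<^sub>R v) = a * \<eta> p v"
  using \<eta>_linear[of v p v a 0] by (simp only: scaleR_zero_left add_0_right mult_zero_left)

lemma \<eta>_zero: "\<eta> p 0 = 0"
  using \<eta>_scaleR[OF tangent_space_zero, of p 0] by (simp only: scaleR_zero_left mult_zero_left)

lemma \<eta>_add:
  "u \<in> tangent_space A p \<Longrightarrow> v \<in> tangent_space A p \<Longrightarrow> \<eta> p (u + v) = \<eta> p u + \<eta> p v"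
  using \<eta>_linear[of u p v 1 1] by (simp only: scaleR_one mult_1)

lemma \<eta>_diff:
  "u \<in> tangent_space A p \<Longrightarrow> v \<in> tangent_space A p \<Longrightarrow> \<eta> p (u - v) = \<eta> p u - \<eta> p v"
  using \<eta>_linear[of u p v 1 "- 1"]
  by (simp only: scaleR_one mult_1 scaleR_minus1_left mult_minus1 diff_conv_add_uminus)

lemma g_commute: "u \<in> tangent_space A p \<Longrightarrow> v \<in> tangent_space A p \<Longrightarrow> g p u v = g p v u"
  using metric_g unfolding riemannian_metric_def by blast

lemma g_linear_left:
  "u \<in> tangent_space A p \<Longrightarrow> v \<in> tangent_space A p \<Longrightarrow> w \<in> tangent_space A p \<Longrightarrow>
    g p (a *\<^sub>R u + b *\<^sub>R v) w = a * g p u w + b * g p v w"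
  using metric_g unfolding riemannian_metric_def by blast

lemma g_linear_right:
  assumes "u \<in> tangent_space A p" "v \<in> tangent_space A p" "w \<in> tangent_space A p"
  shows "g p w (a *\<^sub>R u + b *\<^sub>R v) = a * g p w u + b * g p w v"
  using g_linear_left[OF assms, of a b] assms
  by (simp only: g_commute[of w] tangent_space_add tangent_space_scaleR)

lemma g_scaleR_left:
  "u \<in> tangent_space A p \<Longrightarrow> w \<in> tangent_space A p \<Longrightarrow> g p (a *\<^sub>R u) w = a * g p u w"
  using g_linear_left[of u p u w a 0] by (simp only: scaleR_zero_left add_0_right mult_zero_left)

lemma g_scaleR_right:
  "u \<in> tangent_space A p \<Longrightarrow> w \<in> tangent_space A p \<Longrightarrow> g p w (a *\<^sub>R u) = a * g p w u"
  using g_linear_right[of u p u w a 0] by (simp only: scaleR_zero_left add_0_right mult_zero_left)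

lemma g_pos: "v \<in> tangent_space A p \<Longrightarrow> v \<noteq> 0 \<Longrightarrow> g p v v > 0"
  using metric_g unfolding riemannian_metric_def by blast

lemma g_zero: "v \<in> tangent_space A p \<Longrightarrow> g p 0 v = 0"
  using g_scaleR_left[OF tangent_space_zero, of v p 0] by (simp only: scaleR_zero_left mult_zero_left)

lemma g_nonneg: "v \<in> tangent_space A p \<Longrightarrow> g p v v \<ge> 0"
  using g_pos[of v p] g_zero[of v p] by fastforce

lemma \<phi>_sq_eq:
  assumes "v \<in> tangent_space A p"
  shows "\<phi> p (\<phi> p v) = (- 1) *\<^sub>R Q p v + (\<nu> * \<eta> p v) *\<^sub>R \<xi> p"
  by (simp only: \<phi>_sq[OF assms] Q_\<xi> scaleR_minus1_left scaleR_scaleR mult.commute)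

lemma \<phi>_zero: "\<phi> p 0 = 0"
  using tensor_field11D(3)[OF tensor_\<phi> tangent_space_zero, of p 0] by (simp only: scaleR_zero_left)

text \<open>Put w = phi xi. The formula for phi^2 gives phi w = 0; applied to w it gives Q w =
  eta(w) Q xi, so w = eta(w) xi by injectivity of Q. Then 0 = phi w = eta(w) w.\<close>

lemma \<phi>_\<xi>: "\<phi> p (\<xi> p) = 0"
proof -
  let ?w = "\<phi> p (\<xi> p)"
  have T: "?w \<in> tangent_space A p"
    by (intro \<phi>_tangent \<xi>_tangent)
  have "\<phi> p ?w = 0"
    by (simp only: \<phi>_sq[OF \<xi>_tangent] \<eta>_\<xi> scaleR_one left_minus)
  then have "- Q p ?w + \<eta> p ?w *\<^sub>R Q p (\<xi> p) = 0"
    using \<phi>_sq[OF T] \<phi>_zero by metis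
  then have "Q p ?w = Q p (\<eta> p ?w *\<^sub>R \<xi> p)"
    by (simp only: tensor_field11D(3)[OF tensor_Q \<xi>_tangent] neg_eq_iff_add_eq_0[symmetric] minus_minus)
  then have w: "?w = \<eta> p ?w *\<^sub>R \<xi> p"
    using nonsingular_Q T tangent_space_scaleR[OF \<xi>_tangent]
    unfolding nonsingular_def bij_betw_def inj_on_def by blast
  have "0 = \<phi> p (\<eta> p ?w *\<^sub>R \<xi> p)"
    using w \<open>\<phi> p ?w = 0\<close> by metis
  also have "\<dots> = \<eta> p ?w *\<^sub>R ?w"
    by (rule tensor_field11D(3)[OF tensor_\<phi> \<xi>_tangent])
  finally have "\<eta> p ?w = 0 \<or> ?w = 0"
    by (metis scaleR_eq_0_iff)
  then show ?thesis
    using w by (metis scaleR_zero_left)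
qed

lemma kernel_part:
  assumes "v \<in> tangent_space A p"
  shows "v - \<eta> p v *\<^sub>R \<xi> p \<in> kernel_distribution A \<eta> p"
proof -
  note T = tangent_space_scaleR[OF \<xi>_tangent]
  have "v - \<eta> p v *\<^sub>R \<xi> p \<in> tangent_space A p"
    by (intro tangent_space_diff assms T)
  moreover have "\<eta> p (v - \<eta> p v *\<^sub>R \<xi> p) = 0"
    by (simp only: \<eta>_diff[OF assms T] \<eta>_scaleR[OF \<xi>_tangent] \<eta>_\<xi> mult_1_right diff_self)
  ultimately show ?thesis
    unfolding kernel_distribution_def by blast
qed

text \<open>By phi xi = 0, \<open>\<phi>\<close> takes the same value on v and on its component in
  ker eta, which is invariant.\<close>

lemma \<eta>_\<phi>:
  assumes v: "v \<in> tangent_space A p"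
  shows "\<eta> p (\<phi> p v) = 0"
proof -
  have "\<phi> p (1 *\<^sub>R v + (- \<eta> p v) *\<^sub>R \<xi> p) = 1 *\<^sub>R \<phi> p v + (- \<eta> p v) *\<^sub>R \<phi> p (\<xi> p)"
    by (rule tensor_field11D(2)[OF tensor_\<phi> v \<xi>_tangent])
  then have "\<phi> p (v - \<eta> p v *\<^sub>R \<xi> p) = \<phi> p v"
    by (simp only: \<phi>_\<xi> scaleR_one scaleR_zero_right add_0_right scaleR_minus_left diff_conv_add_uminus)
  then show ?thesis
    using \<phi>_kernel[OF kernel_part[OF v]] by (simp add: kernel_distribution_def)
qed

text \<open>Apply \<open>\<eta>\<close> to the formula for phi^2; the left side vanishes by
  \<open>\<eta>_\<phi>\<close>.\<close>

lemma \<eta>_Q: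
  assumes v: "v \<in> tangent_space A p"
  shows "\<eta> p (Q p v) = \<nu> * \<eta> p v"
proof -
  have "0 = \<eta> p ((- 1) *\<^sub>R Q p v + (\<nu> * \<eta> p v) *\<^sub>R \<xi> p)"
    using \<eta>_\<phi>[OF \<phi>_tangent[OF v]] \<phi>_sq_eq[OF v] by metis
  also have "\<dots> = - \<eta> p (Q p v) + \<nu> * \<eta> p v"
    by (simp only: \<eta>_linear[OF Q_tangent[OF v] \<xi>_tangent] \<eta>_\<xi> mult_minus1 mult_1_right)
  finally show ?thesis by simp
qed

text \<open>Compatibility of g for the pair v, xi has left side 0 because phi xi = 0, and its right
  side is nu (g(v, xi) - eta(v)). So xi is a unit vector orthogonal to ker eta.\<close>

lemma g_\<xi>:
  assumes v: "v \<in> tangent_space A p"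
  shows "g p v (\<xi> p) = \<eta> p v"
proof -
  have "g p (\<phi> p v) 0 = 0"
    using g_commute[OF \<phi>_tangent[OF v] tangent_space_zero] g_zero[OF \<phi>_tangent[OF v]] by simp
  then have "0 = g p v (Q p (\<xi> p)) - \<eta> p v * \<eta> p (Q p (\<xi> p))"
    using g_\<phi>_\<phi>[OF v \<xi>_tangent] \<phi>_\<xi> by metis
  then have "0 = \<nu> * g p v (\<xi> p) - \<eta> p v * \<nu>"
    by (simp only: Q_\<xi> g_scaleR_right[OF \<xi>_tangent v] \<eta>_scaleR[OF \<xi>_tangent] \<eta>_\<xi> mult_1_right)
  then show ?thesis using \<nu>_pos by simp
qed

text \<open>Vectors phi v are orthogonal to xi. This reduces Phi to ker eta, the distribution on
  which a homothety scales the metric.\<close>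

lemma fundamental_form_kernel_part:
  assumes u: "u \<in> tangent_space A p" and v: "v \<in> tangent_space A p"
  shows "g p (u - \<eta> p u *\<^sub>R \<xi> p) (\<phi> p v) = g p u (\<phi> p v)"
proof -
  note \<phi>v = \<phi>_tangent[OF v]
  have "g p (1 *\<^sub>R u + (- \<eta> p u) *\<^sub>R \<xi> p) (\<phi> p v) = 1 * g p u (\<phi> p v) + (- \<eta> p u) * g p (\<xi> p) (\<phi> p v)"
    by (rule g_linear_left[OF u \<xi>_tangent \<phi>v])
  moreover have "g p (\<xi> p) (\<phi> p v) = 0"
    using g_commute[OF \<xi>_tangent \<phi>v] g_\<xi>[OF \<phi>v] \<eta>_\<phi>[OF v] by simp
  ultimately show ?thesis
    by (simp only: scaleR_one scaleR_minus_left diff_conv_add_uminus mult_zero_right mult_1 add_0_right)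
qed

end

section \<open>Consequences of normality and the two implications\<close>

context weak_acm
begin

text \<open>Under \<open>\<eta>\<close> every term of N1 with an outer \<open>\<phi>\<close> dies,
  which leaves eta([phi X, phi Y]) = - 2 nu d eta(X, Y). As eta o phi = 0, the two derivative terms
  of d eta(phi X, phi Y) vanish and only minus half of that bracket term remains.\<close>

lemma normal_ext_deriv:
  assumes normal: "normal_structure A \<phi> Q \<xi> \<eta>" and X: "X \<in> vector_fields A" and Y: "Y \<in> vector_fields A"
  shows "ext_deriv A \<eta> (apply_field \<phi> X) (apply_field \<phi> Y) p = \<nu> * ext_deriv A \<eta> X Y p"
proof -
  note X' = tensor_field11D(4)[OF tensor_\<phi> X] and Y' = tensor_field11D(4)[OF tensor_\<phi> Y]
  note T = lie_bracket_tangent[OF manifold]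
  let ?B = "lie_bracket A (apply_field \<phi> X) (apply_field \<phi> Y) p"
  let ?c = "2 * ext_deriv A \<eta> X Y p"
  have "tensor_N1 A \<phi> Q \<xi> \<eta> X Y p = 0"
    using normal X Y unfolding normal_structure_def by blast
  then have "\<eta> p (\<phi> p (\<phi> p (lie_bracket A X Y p)) + ?B - \<phi> p (lie_bracket A (apply_field \<phi> X) Y p)
      - \<phi> p (lie_bracket A X (apply_field \<phi> Y) p) + ?c *\<^sub>R Q p (\<xi> p)) = 0"
    unfolding tensor_N1_def nijenhuis_def by (simp only: \<eta>_zero)
  moreover have "\<eta> p (\<phi> p (\<phi> p (lie_bracket A X Y p)) + ?B - \<phi> p (lie_bracket A (apply_field \<phi> X) Y p)
      - \<phi> p (lie_bracket A X (apply_field \<phi> Y) p) + ?c *\<^sub>R Q p (\<xi> p)) = 0 + \<eta> p ?B - 0 - 0 + ?c * (\<nu> * 1)"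
    by (simp only: \<eta>_add \<eta>_diff \<eta>_scaleR \<eta>_\<phi> \<phi>_tangent Q_tangent \<xi>_tangent T X X' Y Y'
        tangent_space_add tangent_space_diff tangent_space_scaleR \<eta>_Q \<eta>_\<xi>)
  ultimately have B: "\<eta> p ?B = - (?c * \<nu>)"
    by simp
  have "(\<lambda>q. \<eta> q (apply_field \<phi> Z q)) = (\<lambda>_. 0)" if "Z \<in> vector_fields A" for Z
    using \<eta>_\<phi>[OF vector_fieldsD(1)[OF that]] by (simp add: apply_field_def)
  then show ?thesis
    unfolding ext_deriv_def[of A \<eta> "apply_field \<phi> X"] using X Y B
    by (simp add: tangent_vector_const[OF vector_fieldsD(1)[OF X']] tangent_vector_const[OF vector_fieldsD(1)[OF Y']])
qed

lemma weak_Sasakian_contact: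
  assumes "weak_Sasakian A \<phi> Q \<xi> \<eta> g" "X \<in> vector_fields A" "Y \<in> vector_fields A"
  shows "g p (X p) (\<phi> p (Y p)) = ext_deriv A \<eta> X Y p"
  using assms unfolding weak_Sasakian_def weak_contact_metric_def fundamental_form_def by blast

lemma weak_Sasakian_Q_\<phi>:
  assumes wS: "weak_Sasakian A \<phi> Q \<xi> \<eta> g" and u: "u \<in> tangent_space A p"
  shows "Q p (\<phi> p u) = \<nu> *\<^sub>R \<phi> p u"
proof -
  \<comment> \<open>The test vector \<open>?z\<close> is the difference that is to vanish: the
    identity below becomes g(z, z) = 0. Both \<open>?z\<close> and \<open>u\<close> are extended to
    fields since d eta acts on fields.\<close>
  let ?w = "\<phi> p u" and ?z = "1 *\<^sub>R Q p (\<phi> p u) + (- \<nu>) *\<^sub>R \<phi> p u"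
  note w = \<phi>_tangent[OF u]
  note z = tangent_space_add[OF tangent_space_scaleR[OF Q_tangent[OF w]] tangent_space_scaleR[OF w], of 1 "- \<nu>"]
  obtain X where X: "X \<in> vector_fields A" "X p = ?z"
    using tangent_vector_extends[OF manifold z] by blast
  obtain Y where Y: "Y \<in> vector_fields A" "Y p = u"
    using tangent_vector_extends[OF manifold u] by blast
  note X' = tensor_field11D(4)[OF tensor_\<phi> X(1)] and Y' = tensor_field11D(4)[OF tensor_\<phi> Y(1)]
  have normal: "normal_structure A \<phi> Q \<xi> \<eta>"
    using wS unfolding weak_Sasakian_def by blast
  have "g p (\<phi> p ?z) (\<phi> p ?w) = ext_deriv A \<eta> (apply_field \<phi> X) (apply_field \<phi> Y) p"
    using weak_Sasakian_contact[OF wS X' Y', of p] by (simp only: apply_field_def X(2) Y(2))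
  also have "\<dots> = \<nu> * g p ?z ?w"
    using normal_ext_deriv[OF normal X(1) Y(1)] weak_Sasakian_contact[OF wS X(1) Y(1), of p]
    by (simp only: X(2) Y(2))
  finally have "g p ?z (Q p ?w) - \<eta> p ?z * \<eta> p (Q p ?w) = \<nu> * g p ?z ?w"
    by (simp only: g_\<phi>_\<phi>[OF z w])
  then have "g p ?z (Q p ?w) = \<nu> * g p ?z ?w"
    by (simp only: \<eta>_Q[OF w] \<eta>_\<phi>[OF u] mult_zero_right diff_zero)
  then have "g p ?z ?z = 0"
    unfolding g_linear_right[OF Q_tangent[OF w] w z] by simp
  then have "?z = 0"
    using g_pos[OF z] less_irrefl by metis
  then show ?thesis
    by (simp only: scaleR_one scaleR_minus_left right_minus_eq flip: diff_conv_add_uminus)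
qed

text \<open>On ker eta it suffices that each u is of the form phi x. With u = Q w,
  \<open>\<eta>_Q\<close> puts w in ker eta, so phi^2 w = - u and x = - phi w works. The
  xi-component is covered by \<open>Q_\<xi>\<close>.\<close>

lemma weak_Sasakian_Q:
  assumes wS: "weak_Sasakian A \<phi> Q \<xi> \<eta> g" and v: "v \<in> tangent_space A p"
  shows "Q p v = \<nu> *\<^sub>R v"
proof -
  have ker: "Q p u = \<nu> *\<^sub>R u" if "u \<in> kernel_distribution A \<eta> p" for u
  proof -
    have u: "u \<in> tangent_space A p" "\<eta> p u = 0"
      using that by (simp_all add: kernel_distribution_def)
    have "Q p ` tangent_space A p = tangent_space A p"
      using nonsingular_Q unfolding nonsingular_def bij_betw_def by simp
    then obtain w where w: "w \<in> tangent_space A p" "Q p w = u"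
      using u(1) by (metis imageE)
    have "\<eta> p w = 0"
      using \<eta>_Q[OF w(1)] w(2) u(2) \<nu>_pos by simp
    then have "\<phi> p (\<phi> p w) = (- 1) *\<^sub>R u"
      by (simp only: \<phi>_sq_eq[OF w(1)] w(2) mult_zero_right scaleR_zero_left add_0_right)
    then have "\<phi> p ((- 1) *\<^sub>R \<phi> p w) = u"
      by (simp only: tensor_field11D(3)[OF tensor_\<phi> \<phi>_tangent[OF w(1)]]) simp
    then show ?thesis
      using weak_Sasakian_Q_\<phi>[OF wS tangent_space_scaleR[OF \<phi>_tangent[OF w(1)]]] by metis
  qed
  let ?u = "v - \<eta> p v *\<^sub>R \<xi> p"
  have u: "?u \<in> kernel_distribution A \<eta> p"
    by (rule kernel_part[OF v])
  then have uT: "?u \<in> tangent_space A p"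
    by (simp add: kernel_distribution_def)
  have v_eq: "v = 1 *\<^sub>R ?u + \<eta> p v *\<^sub>R \<xi> p"
    by (simp only: scaleR_one diff_add_cancel)
  have "Q p (1 *\<^sub>R ?u + \<eta> p v *\<^sub>R \<xi> p) = 1 *\<^sub>R Q p ?u + \<eta> p v *\<^sub>R Q p (\<xi> p)"
    by (rule tensor_field11D(2)[OF tensor_Q uT \<xi>_tangent])
  also have "\<dots> = \<nu> *\<^sub>R (1 *\<^sub>R ?u + \<eta> p v *\<^sub>R \<xi> p)"
    by (simp only: ker[OF u] Q_\<xi> scaleR_add_right scaleR_scaleR mult.commute)
  finally show ?thesis
    using v_eq by metis
qed

text \<open>The scale is \<nu> itself. The term in eta (x) eta vanishes on ker eta and restores
  g'(xi, .) = sqrt nu eta + (1 - sqrt nu) eta = eta.\<close>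

lemma weak_Sasakian_imp_homothetic_Sasakian:
  assumes wS: "weak_Sasakian A \<phi> Q \<xi> \<eta> g"
  defines "\<phi>' \<equiv> \<lambda>p v. (1 / sqrt \<nu>) *\<^sub>R \<phi> p v"
    and "g' \<equiv> \<lambda>p u v. sqrt \<nu> * g p u v + (1 - sqrt \<nu>) * (\<eta> p u * \<eta> p v)"
  shows "Sasakian A \<phi>' \<xi> \<eta> g'" and "homothetically_equivalent A \<xi> \<eta> \<phi> Q g \<phi>' id_field g'"
proof -
  define s where "s = sqrt \<nu>"
  have s: "s > 0" "s * s = \<nu>"
    using \<nu>_pos by (simp_all add: s_def)
  have \<phi>': "\<phi>' p v = (1 / s) *\<^sub>R \<phi> p v" and g': "g' p u v = s * g p u v + (1 - s) * (\<eta> p u * \<eta> p v)" for p u v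
    by (simp_all add: \<phi>'_def g'_def s_def)
  have \<phi>_eq: "\<phi> p v = s *\<^sub>R \<phi>' p v" for p v
    using s by (simp add: \<phi>')
  have tensor_\<phi>': "tensor_field11 A \<phi>'"
    unfolding \<phi>'_def by (rule tensor_field11_scaleR[OF manifold tensor_\<phi>])
  have Q: "Q p v = (s * s) *\<^sub>R v" if "v \<in> tangent_space A p" for p v
    using weak_Sasakian_Q[OF wS that] s(2) by simp
  have g_\<phi>: "g p (\<phi> p u) (\<phi> p v) = s * s * (g p u v - \<eta> p u * \<eta> p v)"
    if "u \<in> tangent_space A p" "v \<in> tangent_space A p" for p u v
    by (simp add: g_\<phi>_\<phi>[OF that] Q[OF that(2)] g_scaleR_right[OF that(2,1)] \<eta>_scaleR[OF that(2)]
        algebra_simps)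
  have contact': "weak_almost_contact A \<phi>' id_field \<xi> \<eta>"
    unfolding weak_almost_contact_def
  proof (intro conjI allI ballI)
    fix p v assume v: "v \<in> tangent_space A p"
    have "\<phi>' p (\<phi>' p v) = (1 / (s * s)) *\<^sub>R \<phi> p (\<phi> p v)"
      unfolding \<phi>' by (simp add: tensor_field11D(3)[OF tensor_\<phi> \<phi>_tangent[OF v]])
    also have "\<dots> = (1 / (s * s)) *\<^sub>R ((- 1) *\<^sub>R (s * s) *\<^sub>R v + (s * s * \<eta> p v) *\<^sub>R \<xi> p)"
      by (simp only: \<phi>_sq_eq[OF v] Q[OF v] s(2))
    also have "\<dots> = (- 1) *\<^sub>R v + \<eta> p v *\<^sub>R \<xi> p"
      using s(1) by (simp only: scaleR_add_right scaleR_scaleR) simp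
    also have "\<dots> = - id_field p v + \<eta> p v *\<^sub>R id_field p (\<xi> p)"
      by (simp only: id_field_def scaleR_minus1_left)
    finally show "\<phi>' p (\<phi>' p v) = - id_field p v + \<eta> p v *\<^sub>R id_field p (\<xi> p)" .
  next
    fix p v assume v: "v \<in> kernel_distribution A \<eta> p"
    then have "\<phi> p v \<in> tangent_space A p" "\<eta> p (\<phi> p v) = 0"
      using \<phi>_kernel[OF v] by (simp_all add: kernel_distribution_def)
    then show "\<phi>' p v \<in> kernel_distribution A \<eta> p"
      unfolding \<phi>' kernel_distribution_def by (simp add: \<eta>_scaleR tangent_space_scaleR)
  next
    show "nonsingular A id_field"
      by (simp add: nonsingular_def id_field_def bij_betw_def inj_on_def)
    show "\<exists>\<mu>>0. \<forall>p. id_field p (\<xi> p) = \<mu> *\<^sub>R \<xi> p"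
      by (rule exI[of _ 1]) (simp add: id_field_def)
  qed (rule tensor_\<phi>' tensor_field11_id \<xi>_field one_form_\<eta> \<eta>_\<xi>)+
  have metric': "riemannian_metric A g'"
    unfolding riemannian_metric_def
  proof (intro conjI allI ballI impI)
    show "g' p u v = g' p v u" if "u \<in> tangent_space A p" "v \<in> tangent_space A p" for p u v
      using g_commute[OF that] by (simp add: g')
    show "g' p (a *\<^sub>R u + b *\<^sub>R v) w = a * g' p u w + b * g' p v w"
      if "u \<in> tangent_space A p" "v \<in> tangent_space A p" "w \<in> tangent_space A p" for p u v w a b
      unfolding g' g_linear_left[OF that] \<eta>_linear[OF that(1,2)] by (simp add: algebra_simps)
    show "g' p v v > 0" if v: "v \<in> tangent_space A p" and "v \<noteq> 0" for p v
    proof -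
      \<comment> \<open>As 1 - s may be negative, g'(v, v) is regrouped as s (g(v, v) - eta(v)^2) +
        eta(v)^2. The bracket is nonnegative because s * s times it is g(phi v, phi v).\<close>
      have "s * s * (g p v v - \<eta> p v * \<eta> p v) \<ge> 0"
        using g_nonneg[OF \<phi>_tangent[OF v]] g_\<phi>[OF v v] by simp
      then have ge: "g p v v - \<eta> p v * \<eta> p v \<ge> 0"
        using mult_pos_pos[OF s(1) s(1)] mult_le_cancel_left_pos[of "s * s" 0] by simp
      have eq: "g' p v v = s * (g p v v - \<eta> p v * \<eta> p v) + \<eta> p v * \<eta> p v"
        by (simp add: g' algebra_simps)
      show ?thesis
      proof (cases "\<eta> p v = 0")
        case True
        then show ?thesis using eq g_pos[OF that] s(1) by simp
      next
        case False
        then have "\<eta> p v * \<eta> p v > 0"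
          by (auto simp: zero_less_mult_iff linorder_neq_iff)
        then show ?thesis
          using eq ge s(1) mult_nonneg_nonneg[of s "g p v v - \<eta> p v * \<eta> p v"] by linarith
      qed
    qed
    show "(\<lambda>p. g' p (X p) (Y p)) \<in> smooth_funs A"
      if X: "X \<in> vector_fields A" and Y: "Y \<in> vector_fields A" for X Y
    proof -
      have "(\<lambda>p. g p (X p) (Y p)) \<in> smooth_funs A"
        using metric_g X Y unfolding riemannian_metric_def by blast
      moreover have "(\<lambda>p. \<eta> p (Z p)) \<in> smooth_funs A" if "Z \<in> vector_fields A" for Z
        using one_form_\<eta> that unfolding one_form_def by blast
      ultimately have "s *\<^sub>R (\<lambda>p. g p (X p) (Y p)) + (1 - s) *\<^sub>R ((\<lambda>p. \<eta> p (X p)) * (\<lambda>p. \<eta> p (Y p)))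
          \<in> smooth_funs A"
        using X Y by (intro smooth_funs_add[OF manifold] smooth_funs_scaleR[OF manifold] smooth_funs_mult[OF manifold])
      then show ?thesis
        by (simp add: g' scaleR_fun_def plus_fun_def times_fun_def)
    qed
  qed
  have compat': "g' p (\<phi>' p u) (\<phi>' p v) = g' p u (id_field p v) - \<eta> p u * \<eta> p (id_field p v)"
    if u: "u \<in> tangent_space A p" and v: "v \<in> tangent_space A p" for p u v
  proof -
    note T = \<phi>_tangent[OF u] \<phi>_tangent[OF v]
    \<comment> \<open>The eta term vanishes by \<open>\<eta>_\<phi>\<close>. The factor s of
      \<open>g'\<close> and two factors 1 / s of \<open>\<phi>'\<close> meet the s * s from
      \<open>g_\<phi>\<close>, leaving s.\<close>
    have "g' p (\<phi>' p u) (\<phi>' p v) = s * ((1 / s) * ((1 / s) * g p (\<phi> p u) (\<phi> p v)))"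
      unfolding g' \<phi>'
      by (simp add: g_scaleR_left[OF T(1) tangent_space_scaleR[OF T(2)]] g_scaleR_right[OF T(2,1)]
          \<eta>_scaleR[OF T(1)] \<eta>_\<phi>[OF u])
    also have "\<dots> = s * (g p u v - \<eta> p u * \<eta> p v)"
      using s(1) by (simp add: g_\<phi>[OF u v])
    finally show ?thesis
      by (simp add: g' id_field_def algebra_simps)
  qed
  have fund': "fundamental_form \<phi>' g' X Y p = ext_deriv A \<eta> X Y p"
    if X: "X \<in> vector_fields A" and Y: "Y \<in> vector_fields A" for X Y p
  proof -
    note T = vector_fieldsD(1)[OF X, of p] \<phi>_tangent[OF vector_fieldsD(1)[OF Y, of p]]
    \<comment> \<open>The factor s of \<open>g'\<close> cancels the 1 / s of \<open>\<phi>'\<close>,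
      and the eta term vanishes, so Phi is unchanged.\<close>
    have "g' p (X p) (\<phi>' p (Y p)) = g p (X p) (\<phi> p (Y p))"
      unfolding g' \<phi>' using s(1)
      by (simp add: g_scaleR_right[OF T(2,1)] \<eta>_scaleR[OF T(2)] \<eta>_\<phi>[OF vector_fieldsD(1)[OF Y]])
    then show ?thesis
      using weak_Sasakian_contact[OF wS X Y] by (simp add: fundamental_form_def)
  qed
  have normal': "tensor_N1 A \<phi>' id_field \<xi> \<eta> X Y p = 0"
    if X: "X \<in> vector_fields A" and Y: "Y \<in> vector_fields A" for X Y p
  proof -
    have "Q p (\<xi> p) = (s * s) *\<^sub>R id_field p (\<xi> p)"
      using Q[OF \<xi>_tangent] by (simp add: id_field_def)
    from tensor_N1_homothety[where \<phi> = \<phi> and Q = Q and \<eta> = \<eta> and s = s and \<phi>' = \<phi>'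
          and Q' = id_field and \<xi> = \<xi> and p = p,
        OF manifold tensor_\<phi>' \<phi>_eq this X Y]
    have "(s * s) *\<^sub>R tensor_N1 A \<phi>' id_field \<xi> \<eta> X Y p = 0"
      using wS X Y unfolding weak_Sasakian_def normal_structure_def by metis
    then show ?thesis using s(1) by (simp only: scaleR_eq_0_iff mult_eq_0_iff less_irrefl) simp
  qed
  show "Sasakian A \<phi>' \<xi> \<eta> g'"
    unfolding Sasakian_def weak_Sasakian_def weak_contact_metric_def weak_almost_contact_metric_def
      normal_structure_def
    using contact' metric' compat' fund' normal' by blast
  have "\<nu> powr (- 1 / 2) = 1 / s"
    using powr_minus_divide[of \<nu> "1 / 2"] powr_half_sqrt[of \<nu>] \<nu>_pos by (simp add: s_def)
  moreover have "g p (\<xi> p) v = g' p (\<xi> p) v" if "v \<in> tangent_space A p" for p v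
    using g_\<xi>[OF that] g_commute[OF \<xi>_tangent that] by (simp add: g' \<eta>_\<xi> algebra_simps)
  ultimately show "homothetically_equivalent A \<xi> \<eta> \<phi> Q g \<phi>' id_field g'"
    unfolding homothetically_equivalent_def
    using \<nu>_pos s \<phi>_eq Q \<xi>_tangent
    by (intro exI[of _ \<nu>]) (auto simp: s_def[symmetric] id_field_def kernel_distribution_def g')
qed

text \<open>The weak almost contact metric part is given, so only Phi = d eta and normality have to
  be carried over from the Sasakian structure.\<close>

lemma homothetic_Sasakian_imp_weak_Sasakian:
  assumes S: "Sasakian A \<phi>' \<xi> \<eta> g'"
    and hom: "homothetically_equivalent A \<xi> \<eta> \<phi> Q g \<phi>' id_field g'"
  shows "weak_Sasakian A \<phi> Q \<xi> \<eta> g"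
proof -
  obtain \<kappa> where \<kappa>: "\<kappa> > 0"
    and \<phi>: "\<And>p v. v \<in> tangent_space A p \<Longrightarrow> \<phi> p v = sqrt \<kappa> *\<^sub>R \<phi>' p v"
    and Q: "\<And>p. Q p (\<xi> p) = \<kappa> *\<^sub>R id_field p (\<xi> p)"
    and g: "\<And>p u v. u \<in> kernel_distribution A \<eta> p \<Longrightarrow> v \<in> kernel_distribution A \<eta> p \<Longrightarrow>
      g p u v = \<kappa> powr (- 1 / 2) * g' p u v"
    using hom unfolding homothetically_equivalent_def by (elim exE conjE) (rule that, blast+)
  have S': "weak_almost_contact_metric A \<phi>' id_field \<xi> \<eta> g'"
    using S unfolding Sasakian_def weak_Sasakian_def weak_contact_metric_def by blast
  interpret S: weak_acm A \<phi>' id_field \<xi> \<eta> g' 1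
    by unfold_locales (use manifold S' in \<open>simp_all add: id_field_def\<close>)
  have "\<kappa> powr (- 1 / 2) = 1 / sqrt \<kappa>"
    using powr_minus_divide[of \<kappa> "1 / 2"] powr_half_sqrt[of \<kappa>] \<kappa> by simp
  \<comment> \<open>This product is the total factor on Phi: the metric contributes the first scalar
    and \<open>\<phi>\<close> the second.\<close>
  then have inv: "\<kappa> powr (- 1 / 2) * sqrt \<kappa> = 1"
    using \<kappa> by simp
  have "fundamental_form \<phi> g X Y p = ext_deriv A \<eta> X Y p"
    if X: "X \<in> vector_fields A" and Y: "Y \<in> vector_fields A" for X Y p
  proof -
    \<comment> \<open>The metrics are compared on ker eta. As phi Y lies there, X may be replaced by
      its component in ker eta, and put back afterwards for the Sasakian structure.\<close>
    let ?u = "X p - \<eta> p (X p) *\<^sub>R \<xi> p"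
    note XT = vector_fieldsD(1)[OF X, of p] and YT = vector_fieldsD(1)[OF Y, of p]
    have u: "?u \<in> kernel_distribution A \<eta> p" by (rule kernel_part[OF XT])
    then have uT: "?u \<in> tangent_space A p" by (simp add: kernel_distribution_def)
    have "\<phi> p (Y p) \<in> kernel_distribution A \<eta> p"
      using \<phi>_tangent[OF YT] \<eta>_\<phi>[OF YT] by (simp add: kernel_distribution_def)
    from g[OF u this] have "g p (X p) (\<phi> p (Y p)) = \<kappa> powr (- 1 / 2) * g' p ?u (\<phi> p (Y p))"
      by (simp only: fundamental_form_kernel_part[OF XT YT])
    also have "\<dots> = \<kappa> powr (- 1 / 2) * g' p ?u (sqrt \<kappa> *\<^sub>R \<phi>' p (Y p))"
      by (simp only: \<phi>[OF YT])
    also have "\<dots> = (\<kappa> powr (- 1 / 2) * sqrt \<kappa>) * g' p ?u (\<phi>' p (Y p))"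
      by (simp only: S.g_scaleR_right[OF S.\<phi>_tangent[OF YT] uT] mult.assoc)
    also have "\<dots> = g' p (X p) (\<phi>' p (Y p))"
      by (simp only: inv mult_1 S.fundamental_form_kernel_part[OF XT YT])
    also have "\<dots> = ext_deriv A \<eta> X Y p"
      using S.weak_Sasakian_contact[OF S[unfolded Sasakian_def] X Y] .
    finally show ?thesis
      by (simp only: fundamental_form_def)
  qed
  moreover have "tensor_N1 A \<phi> Q \<xi> \<eta> X Y p = 0"
    if X: "X \<in> vector_fields A" and Y: "Y \<in> vector_fields A" for X Y p
  proof -
    have "Q p (\<xi> p) = (sqrt \<kappa> * sqrt \<kappa>) *\<^sub>R id_field p (\<xi> p)"
      using Q \<kappa> by simp
    from tensor_N1_homothety[where \<phi> = \<phi> and Q = Q and \<eta> = \<eta> and s = "sqrt \<kappa>" and \<phi>' = \<phi>'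
          and Q' = id_field and \<xi> = \<xi> and p = p,
        OF manifold S.tensor_\<phi> \<phi> this X Y]
    have "tensor_N1 A \<phi> Q \<xi> \<eta> X Y p = (sqrt \<kappa> * sqrt \<kappa>) *\<^sub>R tensor_N1 A \<phi>' id_field \<xi> \<eta> X Y p" .
    moreover have "tensor_N1 A \<phi>' id_field \<xi> \<eta> X Y p = 0"
      using S X Y unfolding Sasakian_def weak_Sasakian_def normal_structure_def by blast
    ultimately show ?thesis by (simp only: scaleR_zero_right)
  qed
  ultimately show ?thesis
    using acm unfolding weak_Sasakian_def weak_contact_metric_def normal_structure_def by blast
qed

end

theorem theorem4p1:
  fixes A :: "('a::{t2_space,second_countable_topology}, 'e::euclidean_space) chart set"
    and n :: nat
    and \<phi> Q :: "'a endofield"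
    and \<xi> :: "'a vfield"
    and \<eta> :: "'a oneform"
    and g :: "'a bilinfield"
  assumes "smooth_manifold A"
    and "DIM('e) = 2 * n + 1"
    and "weak_almost_contact_metric A \<phi> Q \<xi> \<eta> g"
  shows "weak_Sasakian A \<phi> Q \<xi> \<eta> g \<longleftrightarrow>
    (\<exists>\<phi>' g'. Sasakian A \<phi>' \<xi> \<eta> g' \<and>
       homothetically_equivalent A \<xi> \<eta> \<phi> Q g \<phi>' id_field g')"
proof -
  obtain \<nu> where "\<nu> > 0" "\<And>p. Q p (\<xi> p) = \<nu> *\<^sub>R \<xi> p"
    using assms(3) unfolding weak_almost_contact_metric_def weak_almost_contact_def by blast
  then interpret weak_acm A \<phi> Q \<xi> \<eta> g \<nu>
    by unfold_locales (use assms in simp_all)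
  show ?thesis
    using weak_Sasakian_imp_homothetic_Sasakian homothetic_Sasakian_imp_weak_Sasakian by blast
qed

end
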